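(* For any positive constant $\epsilon$ there is a positive constant $C=C(\epsilon)$ such that the following holds. Let $A$ be an $n\times n$ real (deterministic) matrix with singular values $\sigma_1\ge\sigma_2\ge\dots\ge\sigma_n\ge0$, and put $\delta:=\sigma_1-\sigma_2$. Let $E$ be an $n\times n$ random Bernoulli matrix, and let $v_1$ and $v_1'$ be first unit singular vectors of $A$ and of $A+E$, respectively. Assume that $A$ has rank $r\le n^{0.99}$ with $r\ge1$, that $\frac{n}{\sqrt{r\log n}}\le\sigma_1$, and that $\delta\ge C\sqrt{r\log n}$. Then with probability $1-o(1)$ $$\sin\angle(v_1,v_1')\le\epsilon.$$
   Context: A random Bernoulli matrix of size $n$ is an $n\times n$ matrix whose entries are iid random variables taking values $+1$ and $-1$ with probability $1/2$ each. For a square matrix $M$ with singular values $\sigma_1(M)\ge\dots\ge\sigma_n(M)$, the corresponding unit singular vectors are the right singular vectors, i.e. an orthonormal basis of eigenvectors of $M^{*}M$ with eigenvalues $\sigma_i(M)^2$; a "first" singular vector corresponds to $\sigma_1(M)$. For unit vectors $v,v'$, $\angle(v,v')$ is the angle between them taken in $[0,\pi/2]$ (so the sign ambiguity of singular vectors is irrelevant), i.e. $\sin^2\angle(v,v')=1-(v\cdot v')^2$. Asymptotic notation is as $n\to\infty$; "with probability $1-o(1)$" means that the probability of the event is at least $1-p_n$ for some sequence $p_n\to0$ depending only on the constant $\epsilon$ and not on the particular matrix $A=A_n$. *)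

theory Defs
  imports
    "HOL-Probability.Product_PMF"
    "Jordan_Normal_Form.Char_Poly"
    "Jordan_Normal_Form.DL_Rank"
begin

text \<open>
  A polynomial's \<open>proots\<close> are counted with multiplicity.  For a real matrix \<open>M\<close>, the matrix
  \<open>M\<^sup>T M\<close> is symmetric and positive semidefinite, so its characteristic polynomial splits over
  the reals, the list below has exactly \<open>dim_col M\<close> entries, and they are all nonnegative.
\<close>

definition singular_values :: "real mat \<Rightarrow> real list" where
  "singular_values M =
     map sqrt (rev (sorted_list_of_multiset (proots (char_poly (transpose_mat M * M)))))"

text \<open>Singular values are indexed from \<open>1\<close>, in nonincreasing order.\<close>

definition singular_value :: "real mat \<Rightarrow> nat \<Rightarrow> real" where
  "singular_value M i = singular_values M ! (i - 1)"

definition right_singular_basis :: "real mat \<Rightarrow> (nat \<Rightarrow> real Matrix.vec) \<Rightarrow> bool" where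
  "right_singular_basis M v \<longleftrightarrow>
     (\<forall>i\<in>{1..dim_col M}. eigenvector (transpose_mat M * M) (v i) ((singular_value M i)\<^sup>2)) \<and>
     (\<forall>i\<in>{1..dim_col M}. \<forall>j\<in>{1..dim_col M}. scalar_prod (v i) (v j) = (if i = j then 1 else 0))"

text \<open>
  The first unit singular vector is not unique (its sign is free, and there is more freedom
  when the largest singular value is repeated), hence a predicate.
\<close>

definition first_singular_vector :: "real mat \<Rightarrow> real Matrix.vec \<Rightarrow> bool" where
  "first_singular_vector M u \<longleftrightarrow> (\<exists>v. right_singular_basis M v \<and> u = v 1)"

text \<open>The angle in \<open>[0, \<pi>/2]\<close> between the lines spanned by two \<^emph>\<open>unit\<close> vectors.\<close>

definition unit_angle :: "real Matrix.vec \<Rightarrow> real Matrix.vec \<Rightarrow> real" where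
  "unit_angle u w = arccos \<bar>scalar_prod u w\<bar>"

text \<open>
  The law of an \<open>n \<times> n\<close> matrix with iid uniform \<open>\<plusminus>1\<close> entries.  The second argument of
  \<open>Pi_pmf\<close> is only the value at indices outside the \<open>n \<times> n\<close> square, which
  \<open>Matrix.mat n n\<close> discards.
\<close>

definition bernoulli_matrix :: "nat \<Rightarrow> real mat pmf" where
  "bernoulli_matrix n =
     map_pmf (Matrix.mat n n) (Pi_pmf ({..<n} \<times> {..<n}) 0 (\<lambda>_. pmf_of_set {1, -1}))"

end

theory Submission
  imports Defs "HOL-Probability.Hoeffding"
begin

text \<open>
  Let \<open>x\<close>, \<open>y\<close> be first right and left singular vectors of \<open>A + E\<close>, with singular value \<open>\<sigma>\<close>.
  Since \<open>A\<close> vanishes on the complement of its row space, the component of \<open>x\<close> there is produced by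
  \<open>E\<close> alone and has norm at most \<open>\<parallel>E\<parallel> / \<sigma>\<close>; likewise for \<open>y\<close> and the column space.  Hence
  \<open>\<sigma> = y \<bullet> A x + y \<bullet> E x \<le> \<sigma>\<^sub>2 + \<delta> \<bar>v\<^sub>1 \<bullet> x\<bar> + T + 2 \<parallel>E\<parallel>\<^sup>2 / \<sigma>\<close>, where \<open>T\<close> bounds \<open>E\<close> compressed to
  the row and column spaces.  Together with \<open>\<sigma> \<ge> \<sigma>\<^sub>1 - T\<close> this gives
  \<open>\<delta> (1 - \<bar>v\<^sub>1 \<bullet> x\<bar>) \<le> 2 T + 4 \<parallel>E\<parallel>\<^sup>2 / \<sigma>\<^sub>1\<close>, which is of order \<open>\<surd>(r log n)\<close> because
  \<open>\<parallel>E\<parallel> = O(\<surd>n)\<close> and \<open>T = O(\<surd>(r log n))\<close> with high probability.  Both bounds come from Hoeffding's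
  inequality and a union bound over the points of norm at most \<open>2\<close> of the lattice
  \<open>\<int>\<^sup>k / \<surd>k\<close>: every vector of the unit ball lies in the convex hull of such points, and there are at
  most \<open>48\<^sup>k\<close> of them.
\<close>

unbundle no inner_syntax and no vec_syntax

section \<open>Tail bounds for sign matrices\<close>

text \<open>Hoeffding's inequality for summands lying in
  \<open>[- \<bar>c i\<bar>, \<bar>c i\<bar>]\<close>: the squared interval lengths add up to four
  times the sum of the \<open>(c i)\<^sup>2\<close>. It needs this total to be positive; if all
  coefficients vanish, the event is empty because \<open>t \<ge> 0\<close>.\<close>

lemma bernoulli_linear_tail:
  fixes c :: "'i \<Rightarrow> real"
  assumes fin: "finite I" and var: "(\<Sum>i\<in>I. (c i)\<^sup>2) \<le> s" and t: "t \<ge> 0"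
  shows "measure_pmf.prob (Pi_pmf I d (\<lambda>_. pmf_of_set {1, -1})) {\<omega>. (\<Sum>i\<in>I. c i * \<omega> i) > t}
           \<le> exp (- t\<^sup>2 / (2 * s))"
proof (cases "(\<Sum>i\<in>I. (c i)\<^sup>2) = 0")
  case True
  then have "\<forall>i\<in>I. c i = 0"
    using fin by (simp add: sum_nonneg_eq_0_iff)
  then have "{\<omega>. (\<Sum>i\<in>I. c i * \<omega> i) > t} = {}"
    using t by auto
  then show ?thesis by simp
next
  case False
  let ?V = "\<Sum>i\<in>I. (c i)\<^sup>2"
  have V: "?V > 0"
    using False by (simp add: less_le sum_nonneg)
  let ?P = "Pi_pmf I d (\<lambda>_. pmf_of_set {1, -1 :: real})"
  have supp: "\<omega> i \<in> {1, -1}" if "\<omega> \<in> set_pmf ?P" "i \<in> I" for \<omega> i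
    using that fin by (auto simp: set_Pi_pmf PiE_dflt_def)
  have mean: "measure_pmf.expectation ?P (\<lambda>\<omega>. c i * \<omega> i) = 0" if "i \<in> I" for i
  proof -
    have "measure_pmf.expectation ?P (\<lambda>\<omega>. c i * \<omega> i)
            = measure_pmf.expectation (map_pmf (\<lambda>\<omega>. \<omega> i) ?P) (\<lambda>x. c i * x)"
      by simp
    also have "map_pmf (\<lambda>\<omega>. \<omega> i) ?P = pmf_of_set {1, -1}"
      using that fin by (subst Pi_pmf_component) auto
    also have "measure_pmf.expectation (pmf_of_set {1, -1 :: real}) (\<lambda>x. c i * x) = 0"
      by (subst integral_pmf_of_set) auto
    finally show ?thesis .
  qed
  interpret Hoeffding_ineq "measure_pmf ?P" I "\<lambda>i \<omega>. c i * \<omega> i" "\<lambda>i. - \<bar>c i\<bar>" "\<lambda>i. \<bar>c i\<bar>" 0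
  proof unfold_locales
    show "prob_space.indep_vars (measure_pmf ?P) (\<lambda>_. borel) (\<lambda>i \<omega>. c i * \<omega> i) I"
      by (rule prob_space.indep_vars_compose2[OF measure_pmf.prob_space_axioms indep_vars_Pi_pmf[OF fin]]) auto
    show "AE \<omega> in measure_pmf ?P. c i * \<omega> i \<in> {- \<bar>c i\<bar>..\<bar>c i\<bar>}" if "i \<in> I" for i
    proof (rule AE_pmfI)
      fix \<omega> assume "\<omega> \<in> set_pmf ?P"
      then show "c i * \<omega> i \<in> {- \<bar>c i\<bar>..\<bar>c i\<bar>}"
        using supp[of \<omega> i] that by auto
    qed
    show "0 \<equiv> \<Sum>i\<in>I. measure_pmf.expectation ?P (\<lambda>\<omega>. c i * \<omega> i)"
      using mean by simp
  qed (use fin in auto)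
  have V4: "(\<Sum>i\<in>I. (\<bar>c i\<bar> - - \<bar>c i\<bar>)\<^sup>2) = 4 * ?V"
    by (simp add: sum_distrib_left power2_eq_square)
  have "measure_pmf.prob ?P {\<omega>. (\<Sum>i\<in>I. c i * \<omega> i) > t}
          \<le> measure_pmf.prob ?P {\<omega>\<in>space (measure_pmf ?P). (\<Sum>i\<in>I. c i * \<omega> i) \<ge> 0 + t}"
    by (intro measure_pmf.finite_measure_mono) auto
  also have "\<dots> \<le> exp (- 2 * t\<^sup>2 / (4 * ?V))"
    using Hoeffding_ineq_ge[OF t] V unfolding V4 by simp
  also have "\<dots> \<le> exp (- t\<^sup>2 / (2 * s))"
  proof -
    have "t\<^sup>2 / (2 * s) \<le> t\<^sup>2 / (2 * ?V)"
      using var V by (intro divide_left_mono) auto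
    then show ?thesis by simp
  qed
  finally show ?thesis .
qed

lemma scalar_prod_mat_eq_sum:
  fixes x y :: "real Matrix.vec"
  assumes "x \<in> carrier_vec n" "y \<in> carrier_vec n"
  shows "x \<bullet> (Matrix.mat n n \<omega> *\<^sub>v y) = (\<Sum>i\<in>{..<n} \<times> {..<n}. x $ fst i * y $ snd i * \<omega> i)"
proof -
  have "x \<bullet> (Matrix.mat n n \<omega> *\<^sub>v y) = (\<Sum>p<n. \<Sum>q<n. x $ p * y $ q * \<omega> (p, q))"
    using assms
    by (auto simp: scalar_prod_def atLeast0LessThan sum_distrib_left mult_ac intro!: sum.cong)
  then show ?thesis
    by (simp add: sum.cartesian_product case_prod_unfold)
qed

text \<open>For fixed \<open>x\<close> and \<open>y\<close> the bilinear form is linear in the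
  independent entries of \<open>E\<close>, with coefficients \<open>x $ p * y $ q\<close>, whose
  squares sum to the product of the two squared norms.\<close>

lemma bernoulli_matrix_bilinear_tail:
  assumes x: "x \<in> carrier_vec n" and y: "y \<in> carrier_vec n"
    and "x \<bullet> x \<le> a" "y \<bullet> y \<le> b" and t: "t \<ge> 0"
  shows "measure_pmf.prob (bernoulli_matrix n) {E. x \<bullet> (E *\<^sub>v y) > t} \<le> exp (- t\<^sup>2 / (2 * (a * b)))"
proof -
  let ?D = "{..<n} \<times> {..<n}"
  have sq: "(\<Sum>p<n. (z $ p)\<^sup>2) = z \<bullet> z" if "z \<in> carrier_vec n" for z :: "real Matrix.vec"
    using that by (auto simp: scalar_prod_def power2_eq_square atLeast0LessThan)
  have "(\<Sum>i\<in>?D. (x $ fst i * y $ snd i)\<^sup>2) = (\<Sum>p<n. (x $ p)\<^sup>2) * (\<Sum>q<n. (y $ q)\<^sup>2)"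
    by (simp add: sum_product sum.cartesian_product case_prod_unfold power_mult_distrib)
  also have "\<dots> = (x \<bullet> x) * (y \<bullet> y)"
    by (simp add: sq x y)
  also have "\<dots> \<le> a * b"
  proof -
    have "0 \<le> x \<bullet> x" "0 \<le> y \<bullet> y"
      by (simp_all add: sum_nonneg x y flip: sq)
    then show ?thesis using assms by (intro mult_mono) auto
  qed
  finally have var: "(\<Sum>i\<in>?D. (x $ fst i * y $ snd i)\<^sup>2) \<le> a * b" .
  show ?thesis
    using bernoulli_linear_tail[OF _ var t] x y
    by (simp add: bernoulli_matrix_def measure_map_pmf vimage_def scalar_prod_mat_eq_sum)
qed

section \<open>Lattice points as a net for the unit ball\<close>

lemma sum_half_powers_int: "(\<Sum>z\<in>{- int m..int m}. (1/2 :: real) ^ nat \<bar>z\<bar>) = 3 - 2 * (1/2) ^ m"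
proof (induction m)
  case (Suc m)
  have "{- int (Suc m)..int (Suc m)} = insert (- int (Suc m)) (insert (int (Suc m)) {- int m..int m})"
    by auto
  then have "(\<Sum>z\<in>{- int (Suc m)..int (Suc m)}. (1/2 :: real) ^ nat \<bar>z\<bar>)
      = (1/2) ^ Suc m + ((1/2) ^ Suc m + (\<Sum>z\<in>{- int m..int m}. (1/2) ^ nat \<bar>z\<bar>))"
    by (simp only:, subst sum.insert, simp, simp, subst sum.insert) (simp_all add: nat_add_distrib)
  then show ?case
    using Suc by simp
qed simp

text \<open>Dividing such a point by \<open>sqrt (card I)\<close> gives a vector of norm at most 2.
  The box provides a finite ambient product set, over which sums of products factor.\<close>

definition short_lattice_points :: "'i set \<Rightarrow> ('i \<Rightarrow> int) set" where
  "short_lattice_points I =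
     {x \<in> I \<rightarrow>\<^sub>E {- int (4 * card I)..int (4 * card I)}. (\<Sum>i\<in>I. (x i)\<^sup>2) \<le> int (4 * card I)}"

lemma finite_short_lattice_points: "finite I \<Longrightarrow> finite (short_lattice_points I)"
  by (rule finite_subset[of _ "I \<rightarrow>\<^sub>E {- int (4 * card I)..int (4 * card I)}"])
     (auto simp: short_lattice_points_def intro!: finite_PiE)

lemma abs_le_square_int: "\<bar>z :: int\<bar> \<le> z\<^sup>2"
  by (metis abs_ge_zero abs_mult_pos linorder_not_less mult_eq_0_iff mult_less_cancel_left1 power2_abs power2_eq_square
      zero_less_abs_iff int_one_le_iff_zero_less mult_le_cancel_left1 order_refl)

text \<open>A weighted count with k = \<open>card I\<close>. Since \<bar>z\<bar> \<le> z^2 for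
  integers, a short point has l1 norm at most 4k, so the weight 2^(4k) times the product of the
  (1/2)^\<bar>x i\<bar> is at least 1 on it. Over the whole box the total weight factors into
  one-dimensional sums, each at most 3, which gives (16 * 3)^k.\<close>

lemma card_short_lattice_points:
  assumes fin: "finite I"
  shows "real (card (short_lattice_points I)) \<le> 48 ^ card I"
proof -
  let ?m = "4 * card I"
  let ?B = "{- int ?m..int ?m}"
  have "real (card (short_lattice_points I)) = (\<Sum>x\<in>short_lattice_points I. 1)"
    by simp
  also have "\<dots> \<le> (\<Sum>x\<in>short_lattice_points I. 2 ^ ?m * (\<Prod>i\<in>I. (1/2) ^ nat \<bar>x i\<bar>))"
  proof (rule sum_mono)
    fix x assume x: "x \<in> short_lattice_points I"
    have "(\<Sum>i\<in>I. int (nat \<bar>x i\<bar>)) \<le> (\<Sum>i\<in>I. (x i)\<^sup>2)"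
      by (intro sum_mono) (simp add: abs_le_square_int)
    also have "\<dots> \<le> int ?m"
      using x by (simp add: short_lattice_points_def)
    finally have "(\<Sum>i\<in>I. nat \<bar>x i\<bar>) \<le> ?m"
      by (metis of_nat_le_iff of_nat_sum)
    then have "(1/2 :: real) ^ ?m \<le> (1/2) ^ (\<Sum>i\<in>I. nat \<bar>x i\<bar>)"
      by (intro power_decreasing) auto
    then have "2 ^ ?m * (1/2 :: real) ^ ?m \<le> 2 ^ ?m * (1/2) ^ (\<Sum>i\<in>I. nat \<bar>x i\<bar>)"
      by (intro mult_left_mono) auto
    then show "1 \<le> 2 ^ ?m * (\<Prod>i\<in>I. (1/2 :: real) ^ nat \<bar>x i\<bar>)"
      by (simp add: power_sum flip: power_mult_distrib)
  qed
  also have "\<dots> \<le> (\<Sum>x\<in>I \<rightarrow>\<^sub>E ?B. 2 ^ ?m * (\<Prod>i\<in>I. (1/2) ^ nat \<bar>x i\<bar>))"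
    using fin by (intro sum_mono2 mult_nonneg_nonneg prod_nonneg) (auto simp: short_lattice_points_def intro!: finite_PiE)
  also have "\<dots> = 2 ^ ?m * (\<Prod>i\<in>I. \<Sum>z\<in>?B. (1/2) ^ nat \<bar>z\<bar>)"
    using fin by (subst prod_sum_PiE) (auto simp: sum_distrib_left)
  also have "\<dots> \<le> 2 ^ ?m * 3 ^ card I"
    by (simp only: sum_half_powers_int prod_constant, intro mult_left_mono power_mono)
       (auto intro: order_trans[of _ "2 :: real"] simp: power_le_one)
  also have "\<dots> = 48 ^ card I"
    by (simp add: power_mult flip: power_mult_distrib)
  finally show ?thesis .
qed

text \<open>Each coordinate is rounded in the direction that does not decrease the functional.\<close>

lemma short_lattice_point_dominates:
  fixes a c :: "'i \<Rightarrow> real"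
  assumes fin: "finite I" and a: "(\<Sum>i\<in>I. (a i)\<^sup>2) \<le> 1"
  shows "\<exists>x\<in>short_lattice_points I. (\<Sum>i\<in>I. a i * c i) \<le> (\<Sum>i\<in>I. real_of_int (x i) / sqrt (card I) * c i)"
proof (cases "I = {}")
  case True
  then show ?thesis by (auto simp: short_lattice_points_def)
next
  case False
  let ?k = "sqrt (card I)"
  have k: "?k > 0" using False fin by (simp add: card_gt_0_iff)
  define x where "x = (\<lambda>i\<in>I. if c i \<ge> 0 then \<lceil>?k * a i\<rceil> else \<lfloor>?k * a i\<rfloor>)"
  \<comment> \<open>Rounding moves b = \<open>?k * a i\<close> by at most 1. Adding twice (x - b)^2
    \<le> 1 to 0 \<le> (x - 2 b)^2 yields x^2 \<le> 2 b^2 + 2. Summed over \<open>I\<close> this is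
    at most 2k + 2k, the bound 4k in \<open>short_lattice_points\<close>.\<close>
  have x_sq: "(real_of_int (x i))\<^sup>2 \<le> 2 * card I * (a i)\<^sup>2 + 2" if "i \<in> I" for i
  proof -
    have "\<bar>real_of_int (x i) - ?k * a i\<bar> \<le> 1"
      using that unfolding x_def by (auto simp: abs_if) linarith+
    then have "(real_of_int (x i) - ?k * a i)\<^sup>2 \<le> 1"
      by (simp add: abs_square_le_1)
    moreover have "0 \<le> (real_of_int (x i) - 2 * (?k * a i))\<^sup>2" by simp
    moreover have "(?k * a i)\<^sup>2 = card I * (a i)\<^sup>2" by (simp add: power_mult_distrib)
    ultimately show ?thesis by (simp add: power2_eq_square algebra_simps)
  qed
  have "real_of_int (\<Sum>i\<in>I. (x i)\<^sup>2) \<le> (\<Sum>i\<in>I. 2 * card I * (a i)\<^sup>2 + 2)"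
    unfolding of_int_sum of_int_power using x_sq by (rule sum_mono)
  also have "\<dots> = 2 * card I * (\<Sum>i\<in>I. (a i)\<^sup>2) + 2 * card I"
    by (simp add: sum.distrib sum_distrib_left)
  also have "\<dots> \<le> 2 * card I * 1 + 2 * card I"
    using mult_left_mono[OF a, of "2 * card I"] by simp
  finally have sum_sq: "(\<Sum>i\<in>I. (x i)\<^sup>2) \<le> int (4 * card I)"
    by linarith
  have "\<bar>x i\<bar> \<le> int (4 * card I)" if "i \<in> I" for i
    using abs_le_square_int[of "x i"] member_le_sum[of i I "\<lambda>i. (x i)\<^sup>2"] that fin sum_sq by simp
  then have "x \<in> short_lattice_points I"
    unfolding short_lattice_points_def using sum_sq
    by (auto simp: x_def abs_le_iff PiE_iff extensional_def) (force simp: x_def)+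
  moreover have "a i * c i \<le> real_of_int (x i) / ?k * c i" if "i \<in> I" for i
  proof (cases "c i \<ge> 0")
    case True
    then have "?k * a i \<le> real_of_int (x i)" using that by (simp add: x_def)
    then have "a i \<le> real_of_int (x i) / ?k" using k by (simp add: field_simps)
    then show ?thesis using True by (rule mult_right_mono)
  next
    case False
    then have "?k * a i \<ge> real_of_int (x i)" using that by (simp add: x_def)
    then have "a i \<ge> real_of_int (x i) / ?k" using k by (simp add: field_simps)
    then show ?thesis using False by (intro mult_right_mono_neg) auto
  qed
  ultimately show ?thesis by (auto intro!: bexI[of _ x] sum_mono)
qed

section \<open>Orthonormal families of vectors\<close>

lemma scalar_prod_self_nonneg: "0 \<le> (x :: real Matrix.vec) \<bullet> x"
  by (simp add: scalar_prod_def sum_nonneg)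

lemma scalar_prod_Cauchy_Schwarz:
  fixes x y :: "real Matrix.vec"
  assumes "x \<in> carrier_vec n" "y \<in> carrier_vec n"
  shows "\<bar>x \<bullet> y\<bar> \<le> sqrt (x \<bullet> x) * sqrt (y \<bullet> y)"
proof -
  have "\<bar>x \<bullet> y\<bar> \<le> (\<Sum>i\<in>{0..<n}. \<bar>x $ i\<bar> * \<bar>y $ i\<bar>)"
    using assms sum_abs[of "\<lambda>i. x $ i * y $ i" "{0..<n}"] by (simp add: scalar_prod_def abs_mult)
  also have "\<dots> \<le> L2_set (($) x) {0..<n} * L2_set (($) y) {0..<n}"
    by (rule L2_set_mult_ineq)
  also have "\<dots> = sqrt (x \<bullet> x) * sqrt (y \<bullet> y)"
    using assms by (simp add: L2_set_def scalar_prod_def power2_eq_square)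
  finally show ?thesis .
qed

text \<open>Coefficients are attached to indices instead of vectors, so the family need not be
  injective, and the coordinates are explicit finite sums.\<close>

definition combo :: "nat \<Rightarrow> 'i set \<Rightarrow> ('i \<Rightarrow> real) \<Rightarrow> ('i \<Rightarrow> real Matrix.vec) \<Rightarrow> real Matrix.vec" where
  "combo n I a u = Matrix.vec n (\<lambda>k. \<Sum>i\<in>I. a i * u i $ k)"

lemma combo_carrier [simp]: "combo n I a u \<in> carrier_vec n"
  by (simp add: combo_def)

lemma scalar_prod_combo_right:
  assumes "x \<in> carrier_vec n" "\<And>i. i \<in> I \<Longrightarrow> u i \<in> carrier_vec n"
  shows "x \<bullet> combo n I a u = (\<Sum>i\<in>I. a i * (x \<bullet> u i))"
proof -
  have "x \<bullet> combo n I a u = (\<Sum>k\<in>{0..<n}. \<Sum>i\<in>I. a i * (x $ k * u i $ k))"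
    by (simp add: scalar_prod_def combo_def sum_distrib_left mult_ac)
  also have "\<dots> = (\<Sum>i\<in>I. a i * (\<Sum>k\<in>{0..<n}. x $ k * u i $ k))"
    by (subst sum.swap) (simp add: sum_distrib_left)
  also have "\<dots> = (\<Sum>i\<in>I. a i * (x \<bullet> u i))"
    by (intro sum.cong) (simp_all add: scalar_prod_def carrier_vecD[OF assms(2)])
  finally show ?thesis .
qed

lemma scalar_prod_combo_left:
  assumes "x \<in> carrier_vec n" "\<And>i. i \<in> I \<Longrightarrow> u i \<in> carrier_vec n"
  shows "combo n I a u \<bullet> x = (\<Sum>i\<in>I. a i * (u i \<bullet> x))"
proof -
  have "combo n I a u \<bullet> x = x \<bullet> combo n I a u"
    by (rule comm_scalar_prod[OF combo_carrier assms(1)])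
  also have "\<dots> = (\<Sum>i\<in>I. a i * (x \<bullet> u i))"
    by (rule scalar_prod_combo_right[OF assms])
  also have "\<dots> = (\<Sum>i\<in>I. a i * (u i \<bullet> x))"
    using assms by (intro sum.cong refl arg_cong2[where f = "(*)"] comm_scalar_prod[of _ n]) auto
  finally show ?thesis .
qed

lemma scalar_prod_mult_mat_combo:
  assumes A: "A \<in> carrier_mat m n" and x: "x \<in> carrier_vec m"
    and u: "\<And>i. i \<in> I \<Longrightarrow> u i \<in> carrier_vec n"
  shows "x \<bullet> (A *\<^sub>v combo n I a u) = (\<Sum>i\<in>I. a i * (x \<bullet> (A *\<^sub>v u i)))"
proof -
  have "x \<bullet> (A *\<^sub>v combo n I a u) = (transpose_mat A *\<^sub>v x) \<bullet> combo n I a u"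
    by (rule transpose_vec_mult_scalar[OF A combo_carrier x, symmetric])
  also have "\<dots> = (\<Sum>i\<in>I. a i * ((transpose_mat A *\<^sub>v x) \<bullet> u i))"
    using A x u by (intro scalar_prod_combo_right) auto
  also have "\<dots> = (\<Sum>i\<in>I. a i * (x \<bullet> (A *\<^sub>v u i)))"
    using transpose_vec_mult_scalar[OF A u x] by simp
  finally show ?thesis .
qed

definition orthonormal_family :: "nat \<Rightarrow> 'i set \<Rightarrow> ('i \<Rightarrow> real Matrix.vec) \<Rightarrow> bool" where
  "orthonormal_family n I u \<longleftrightarrow>
     (\<forall>i\<in>I. u i \<in> carrier_vec n) \<and> (\<forall>i\<in>I. \<forall>j\<in>I. u i \<bullet> u j = (if i = j then 1 else 0))"

lemma orthonormal_familyD: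
  assumes "orthonormal_family n I u"
  shows "i \<in> I \<Longrightarrow> u i \<in> carrier_vec n"
    and "i \<in> I \<Longrightarrow> j \<in> I \<Longrightarrow> u i \<bullet> u j = (if i = j then 1 else 0)"
  using assms by (auto simp: orthonormal_family_def)

lemma scalar_prod_orthonormal_combo:
  assumes fin: "finite I" and u: "orthonormal_family n I u" and i: "i \<in> I"
  shows "u i \<bullet> combo n I a u = a i"
proof -
  have "u i \<bullet> combo n I a u = (\<Sum>j\<in>I. a j * (if i = j then 1 else 0))"
    using orthonormal_familyD[OF u] i by (simp add: scalar_prod_combo_right)
  then show ?thesis using fin i by (simp add: if_distrib cong: if_cong)
qed

lemma orthonormal_combo_self:
  assumes fin: "finite I" and u: "orthonormal_family n I u"
  shows "combo n I a u \<bullet> combo n I a u = (\<Sum>i\<in>I. (a i)\<^sup>2)"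
proof -
  have "combo n I a u \<bullet> combo n I a u = (\<Sum>i\<in>I. a i * (u i \<bullet> combo n I a u))"
    by (rule scalar_prod_combo_left) (use orthonormal_familyD(1)[OF u] in auto)
  also have "\<dots> = (\<Sum>i\<in>I. (a i)\<^sup>2)"
    using scalar_prod_orthonormal_combo[OF fin u] by (simp add: power2_eq_square)
  finally show ?thesis .
qed

text \<open>The projection \<open>?p\<close> of \<open>x\<close> satisfies
  \<open>?p \<bullet> x = ?p \<bullet> ?p\<close>, so Cauchy-Schwarz bounds the norm of
  \<open>?p\<close> by that of \<open>x\<close>.\<close>

lemma bessel_inequality:
  assumes fin: "finite I" and u: "orthonormal_family n I u" and x: "x \<in> carrier_vec n"
  shows "(\<Sum>i\<in>I. (u i \<bullet> x)\<^sup>2) \<le> x \<bullet> x"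
proof -
  let ?p = "combo n I (\<lambda>i. u i \<bullet> x) u"
  have px: "?p \<bullet> x = (\<Sum>i\<in>I. (u i \<bullet> x)\<^sup>2)"
    using orthonormal_familyD(1)[OF u] x by (simp add: scalar_prod_combo_left power2_eq_square)
  have "\<bar>?p \<bullet> x\<bar> \<le> sqrt (?p \<bullet> ?p) * sqrt (x \<bullet> x)"
    by (rule scalar_prod_Cauchy_Schwarz) (use x in auto)
  moreover have "?p \<bullet> ?p = ?p \<bullet> x"
    by (simp only: px orthonormal_combo_self[OF fin u])
  moreover have nonneg: "?p \<bullet> x \<ge> 0"
    by (simp add: px sum_nonneg)
  ultimately have le: "sqrt (?p \<bullet> x) * sqrt (?p \<bullet> x) \<le> sqrt (?p \<bullet> x) * sqrt (x \<bullet> x)"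
    by (simp only: abs_of_nonneg real_sqrt_mult_self)
  have "?p \<bullet> x \<le> x \<bullet> x"
  proof (cases "?p \<bullet> x = 0")
    case False
    with nonneg have "sqrt (?p \<bullet> x) > 0" by simp
    then show ?thesis using mult_left_le_imp_le[OF le] by (simp only: real_sqrt_le_iff)
  qed (simp add: scalar_prod_self_nonneg)
  then show ?thesis by (simp add: px)
qed

text \<open>The square matrix \<open>?V\<close> with the family as columns has its transpose as left
  inverse, hence also as right inverse; the expansion is \<open>?V\<close> times its transpose
  applied to \<open>x\<close>.\<close>

lemma orthonormal_basis_expansion:
  assumes fin: "finite I" and card: "card I = n" and u: "orthonormal_family n I u"
    and x: "x \<in> carrier_vec n"
  shows "combo n I (\<lambda>i. u i \<bullet> x) u = x"
proof -
  obtain f where f: "bij_betw f {0..<n} I"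
    using ex_bij_betw_nat_finite[OF fin] card by blast
  let ?V = "Matrix.mat n n (\<lambda>(k, i). u (f i) $ k)"
  have fI: "f i \<in> I" if "i < n" for i using f that by (auto simp: bij_betw_def)
  have inj: "f i = f j \<longleftrightarrow> i = j" if "i < n" "j < n" for i j
    using f that by (auto simp: bij_betw_def inj_on_def)
  have V: "?V \<in> carrier_mat n n" by simp
  have "transpose_mat ?V * ?V = 1\<^sub>m n"
  proof (rule eq_matI)
    fix i j assume ij: "i < dim_row (1\<^sub>m n)" "j < dim_col (1\<^sub>m n)"
    then have "(transpose_mat ?V * ?V) $$ (i, j) = u (f i) \<bullet> u (f j)"
      using orthonormal_familyD(1)[OF u fI[of j]] by (auto simp: scalar_prod_def)
    then show "(transpose_mat ?V * ?V) $$ (i, j) = 1\<^sub>m n $$ (i, j)"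
      using ij fI inj orthonormal_familyD(2)[OF u] by simp
  qed auto
  then have VV: "?V * transpose_mat ?V = 1\<^sub>m n"
    by (rule mat_mult_left_right_inverse[rotated 2]) auto
  have "combo n I (\<lambda>i. u i \<bullet> x) u = ?V *\<^sub>v (transpose_mat ?V *\<^sub>v x)"
  proof (rule eq_vecI)
    fix k assume k: "k < dim_vec (?V *\<^sub>v (transpose_mat ?V *\<^sub>v x))"
    have "(?V *\<^sub>v (transpose_mat ?V *\<^sub>v x)) $ k = (\<Sum>i\<in>{0..<n}. u (f i) $ k * (u (f i) \<bullet> x))"
      using k x by (auto simp: scalar_prod_def)
    also have "\<dots> = (\<Sum>i\<in>I. u i $ k * (u i \<bullet> x))"
      by (rule sum.reindex_bij_betw[OF f])
    finally show "combo n I (\<lambda>i. u i \<bullet> x) u $ k = (?V *\<^sub>v (transpose_mat ?V *\<^sub>v x)) $ k"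
      using k by (simp add: combo_def mult.commute)
  qed (simp add: combo_def)
  also have "\<dots> = x"
    using x VV by (subst assoc_mult_mat_vec[OF V _ x, symmetric]) auto
  finally show ?thesis .
qed

lemma orthonormal_basis_parseval:
  assumes "finite I" "card I = n" "orthonormal_family n I u" "x \<in> carrier_vec n"
  shows "x \<bullet> x = (\<Sum>i\<in>I. (u i \<bullet> x)\<^sup>2)"
  using orthonormal_combo_self[OF assms(1,3), of "\<lambda>i. u i \<bullet> x"]
  unfolding orthonormal_basis_expansion[OF assms] .

text \<open>Nonzero pairwise orthogonal vectors are linearly independent, and the images
  \<open>A *\<^sub>v w i\<close> lie in the column space, whose dimension is the rank. They are also
  pairwise distinct, so passing from \<open>I\<close> to the set of images loses no
  cardinality.\<close>

lemma orthogonal_mult_vectors_le_rank: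
  fixes A :: "real mat"
  assumes A: "A \<in> carrier_mat n m" and finI: "finite I"
    and w: "\<And>i. i \<in> I \<Longrightarrow> w i \<in> carrier_vec m"
    and orth: "\<And>i j. i \<in> I \<Longrightarrow> j \<in> I \<Longrightarrow> i \<noteq> j \<Longrightarrow> (A *\<^sub>v w i) \<bullet> (A *\<^sub>v w j) = 0"
    and nz: "\<And>i. i \<in> I \<Longrightarrow> (A *\<^sub>v w i) \<bullet> (A *\<^sub>v w i) \<noteq> 0"
  shows "card I \<le> vec_space.rank n A"
proof -
  interpret vec_space "TYPE(real)" n .
  let ?y = "\<lambda>i. A *\<^sub>v w i"
  let ?S = "span (set (cols A))"
  have cols: "set (cols A) \<subseteq> carrier_vec n"
    using cols_dim[of A] A by auto
  have y: "?y i \<in> carrier_vec n" if "i \<in> I" for i using A w that by auto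
  then have yI: "?y ` I \<subseteq> carrier_vec n" by auto
  have inj: "inj_on ?y I"
  proof (rule inj_onI, rule ccontr)
    fix i j assume "i \<in> I" "j \<in> I" "?y i = ?y j" "i \<noteq> j"
    then show False using orth[of i j] nz[of i] by simp
  qed
  have span: "?y ` I \<subseteq> ?S"
  proof
    fix v assume "v \<in> ?y ` I"
    then show "v \<in> ?S"
      using col_space_eq[OF A] A w unfolding col_space_def by auto
  qed
  have "lin_indpt (?y ` I)"
  proof (rule finite_lin_indpt2)
    show "finite (?y ` I)" using finI by simp
    show "?y ` I \<subseteq> carrier_vec n" by (rule yI)
    fix a :: "real Matrix.vec \<Rightarrow> real"
    assume zero: "lincomb a (?y ` I) = 0\<^sub>v n"
    show "\<forall>v\<in>?y ` I. a v = 0"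
    proof clarify
      fix i assume i: "i \<in> I"
      have "lincomb a (?y ` I) = combo n (?y ` I) a id"
      proof (rule eq_vecI)
        show "dim_vec (lincomb a (?y ` I)) = dim_vec (combo n (?y ` I) a id)"
          by (simp add: combo_def lincomb_dim[OF finite_imageI[OF finI] yI])
        fix k assume "k < dim_vec (combo n (?y ` I) a id)"
        then show "lincomb a (?y ` I) $ k = combo n (?y ` I) a id $ k"
          by (subst lincomb_index[OF _ yI]) (simp_all add: combo_def)
      qed
      then have "combo n (?y ` I) a id = 0\<^sub>v n"
        using zero by simp
      then have "0 = ?y i \<bullet> combo n (?y ` I) a id"
        using scalar_prod_right_zero[OF y[OF i]] by simp
      also have "\<dots> = (\<Sum>v\<in>?y ` I. a v * (?y i \<bullet> v))"
        using y i by (subst scalar_prod_combo_right) auto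
      also have "\<dots> = (\<Sum>j\<in>I. a (?y j) * (?y i \<bullet> ?y j))"
        by (rule sum.reindex_cong[OF inj]) auto
      also have "\<dots> = (\<Sum>j\<in>I. if j = i then a (?y i) * (?y i \<bullet> ?y i) else 0)"
        using orth[OF i] by (intro sum.cong) auto
      also have "\<dots> = a (?y i) * (?y i \<bullet> ?y i)"
        using finI i by simp
      finally show "a (?y i) = 0"
        using nz[OF i] by simp
    qed
  qed
  then have indpt: "LinearCombinations.module.lin_indpt class_ring (span_vs (set (cols A))) (?y ` I)"
    using span_li_not_depend(2)[OF span span_is_submodule[OF cols]] by simp
  have vs: "vectorspace class_ring (span_vs (set (cols A)))"
    using span_is_subspace[OF cols] subspace_is_vs by auto
  have "card (?y ` I) \<le> rank A"
    unfolding rank_def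
    by (rule vectorspace.li_le_dim(2)[OF vs _ _ indpt])
       (use fin_dim_span_cols[OF A] span in auto)
  then show ?thesis
    using inj by (simp add: card_image)
qed

section \<open>Norm bounds for random sign matrices\<close>

lemma set_pmf_bernoulli_matrix: "E \<in> set_pmf (bernoulli_matrix n) \<Longrightarrow> E \<in> carrier_mat n n"
  by (auto simp: bernoulli_matrix_def)

text \<open>A net argument whose cost depends on \<open>card I\<close> and not on \<open>n\<close>.
  The form is dominated by its value at a pair of rescaled lattice points; there are at most
  (48^k)^2 = 2304^k pairs, and each pair has squared norms at most 4, hence the exponent T^2 / (2 *
  4 * 4).\<close>

lemma bernoulli_matrix_orthonormal_tail:
  fixes u w :: "'i \<Rightarrow> real Matrix.vec"
  assumes fin: "finite I" and u: "orthonormal_family n I u" and w: "orthonormal_family n I w"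
    and T: "T \<ge> 0"
  shows "measure_pmf.prob (bernoulli_matrix n)
           {E. \<exists>a b. (\<Sum>i\<in>I. (a i)\<^sup>2) \<le> 1 \<and> (\<Sum>i\<in>I. (b i)\<^sup>2) \<le> 1 \<and>
                     (\<Sum>i\<in>I. \<Sum>j\<in>I. a i * b j * (u i \<bullet> (E *\<^sub>v w j))) > T}
         \<le> 2304 ^ card I * exp (- T\<^sup>2 / 32)"
    (is "measure_pmf.prob _ ?bad \<le> _")
proof -
  let ?prob = "measure_pmf.prob (bernoulli_matrix n)"
  let ?S = "short_lattice_points I"
  define c where "c = (\<lambda>x :: 'i \<Rightarrow> int. \<lambda>i. real_of_int (x i) / sqrt (card I))"
  let ?G = "\<lambda>x y. {E. combo n I (c x) u \<bullet> (E *\<^sub>v combo n I (c y) w) > T}"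
  have c_sq: "(\<Sum>i\<in>I. (c x i)\<^sup>2) \<le> 4" if "x \<in> ?S" for x
  proof -
    have "(\<Sum>i\<in>I. (c x i)\<^sup>2) = real_of_int (\<Sum>i\<in>I. (x i)\<^sup>2) / card I"
      by (simp add: c_def power_divide sum_divide_distrib)
    also have "\<dots> \<le> real_of_int (int (4 * card I)) / card I"
      using that by (intro divide_right_mono) (simp_all only: of_int_le_iff short_lattice_points_def, auto)
    also have "\<dots> \<le> 4"
      by simp
    finally show ?thesis .
  qed
  have uC: "u i \<in> carrier_vec n" and wC: "w i \<in> carrier_vec n" if "i \<in> I" for i
    using that orthonormal_familyD(1)[OF u] orthonormal_familyD(1)[OF w] by auto
  have G: "?prob (?G x y) \<le> exp (- T\<^sup>2 / 32)" if "x \<in> ?S" "y \<in> ?S" for x y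
    using bernoulli_matrix_bilinear_tail[of "combo n I (c x) u" n "combo n I (c y) w" 4 4 T] that T
    by (simp add: orthonormal_combo_self fin u w c_sq)
  \<comment> \<open>Intersecting with the support ensures that \<open>E\<close> is an n by n
    matrix.\<close>
  have cover: "?bad \<inter> set_pmf (bernoulli_matrix n) \<subseteq> (\<Union>x\<in>?S. \<Union>y\<in>?S. ?G x y)"
  proof
    fix E assume "E \<in> ?bad \<inter> set_pmf (bernoulli_matrix n)"
    then obtain a b where E: "E \<in> carrier_mat n n"
      and a: "(\<Sum>i\<in>I. (a i)\<^sup>2) \<le> 1" and b: "(\<Sum>i\<in>I. (b i)\<^sup>2) \<le> 1"
      and gt: "(\<Sum>i\<in>I. \<Sum>j\<in>I. a i * b j * (u i \<bullet> (E *\<^sub>v w j))) > T"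
      using set_pmf_bernoulli_matrix by auto
    let ?f = "\<lambda>i j. u i \<bullet> (E *\<^sub>v w j)"
    \<comment> \<open>The form is linear in each argument separately: first \<open>a\<close> is
      replaced by a lattice point with \<open>b\<close> fixed, then \<open>b\<close> with that
      lattice point fixed.\<close>
    obtain x where x: "x \<in> ?S"
      "(\<Sum>i\<in>I. a i * (\<Sum>j\<in>I. b j * ?f i j)) \<le> (\<Sum>i\<in>I. c x i * (\<Sum>j\<in>I. b j * ?f i j))"
      using short_lattice_point_dominates[OF fin a, of "\<lambda>i. \<Sum>j\<in>I. b j * ?f i j"] unfolding c_def by blast
    obtain y where y: "y \<in> ?S"
      "(\<Sum>j\<in>I. b j * (\<Sum>i\<in>I. c x i * ?f i j)) \<le> (\<Sum>j\<in>I. c y j * (\<Sum>i\<in>I. c x i * ?f i j))"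
      using short_lattice_point_dominates[OF fin b, of "\<lambda>j. \<Sum>i\<in>I. c x i * ?f i j"] unfolding c_def by blast
    have "T < (\<Sum>i\<in>I. a i * (\<Sum>j\<in>I. b j * ?f i j))"
      using gt by (simp add: sum_distrib_left mult.assoc)
    also note x(2)
    also have "(\<Sum>i\<in>I. c x i * (\<Sum>j\<in>I. b j * ?f i j)) = (\<Sum>j\<in>I. b j * (\<Sum>i\<in>I. c x i * ?f i j))"
      unfolding sum_distrib_left by (subst sum.swap) (intro sum.cong refl mult.left_commute)
    also note y(2)
    also have "(\<Sum>j\<in>I. c y j * (\<Sum>i\<in>I. c x i * ?f i j)) = (\<Sum>j\<in>I. c y j * (combo n I (c x) u \<bullet> (E *\<^sub>v w j)))"
      using E uC wC by (intro sum.cong refl) (subst scalar_prod_combo_left[of _ n], auto)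
    also have "\<dots> = combo n I (c x) u \<bullet> (E *\<^sub>v combo n I (c y) w)"
      by (rule scalar_prod_mult_mat_combo[OF E combo_carrier wC, symmetric])
    finally show "E \<in> (\<Union>x\<in>?S. \<Union>y\<in>?S. ?G x y)"
      using x(1) y(1) by blast
  qed
  have finS: "finite ?S" by (rule finite_short_lattice_points[OF fin])
  have "?prob ?bad = ?prob (?bad \<inter> set_pmf (bernoulli_matrix n))"
    by (rule measure_Int_set_pmf[symmetric])
  also have "\<dots> \<le> ?prob (\<Union>x\<in>?S. \<Union>y\<in>?S. ?G x y)"
    using cover by (intro measure_pmf.finite_measure_mono) auto
  also have "\<dots> \<le> (\<Sum>x\<in>?S. ?prob (\<Union>y\<in>?S. ?G x y))"
    using finS by (intro measure_pmf.finite_measure_subadditive_finite) auto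
  also have "\<dots> \<le> (\<Sum>x\<in>?S. \<Sum>y\<in>?S. ?prob (?G x y))"
    using finS by (intro sum_mono measure_pmf.finite_measure_subadditive_finite) auto
  also have "\<dots> \<le> (\<Sum>x\<in>?S. \<Sum>y\<in>?S. exp (- T\<^sup>2 / 32))"
    by (intro sum_mono G)
  also have "\<dots> = (real (card ?S))\<^sup>2 * exp (- T\<^sup>2 / 32)"
    by (simp add: power2_eq_square)
  also have "\<dots> \<le> (48 ^ card I)\<^sup>2 * exp (- T\<^sup>2 / 32)"
    by (intro mult_right_mono power_mono card_short_lattice_points fin) auto
  also have "(48 ^ card I)\<^sup>2 = (2304 :: real) ^ card I"
    by (simp add: power2_eq_square flip: power_mult_distrib)
  finally show ?thesis .
qed

lemma orthonormal_family_unit_vec: "orthonormal_family n {..<n} (unit_vec n)"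
  by (auto simp: orthonormal_family_def)

lemma scalar_prod_mult_mat_eq_sum:
  fixes x y :: "real Matrix.vec"
  assumes E: "E \<in> carrier_mat n n" and x: "x \<in> carrier_vec n" and y: "y \<in> carrier_vec n"
  shows "x \<bullet> (E *\<^sub>v y) = (\<Sum>i<n. \<Sum>j<n. x $ i * y $ j * (unit_vec n i \<bullet> (E *\<^sub>v unit_vec n j)))"
proof -
  have "x \<bullet> (E *\<^sub>v y) = (\<Sum>i<n. \<Sum>j<n. x $ i * y $ j * E $$ (i, j))"
    using assms
    by (auto simp: scalar_prod_def atLeast0LessThan sum_distrib_left mult_ac intro!: sum.cong)
  moreover have "unit_vec n i \<bullet> (E *\<^sub>v unit_vec n j) = E $$ (i, j)" if "i < n" "j < n" for i j
    using that E by (simp add: scalar_prod_left_unit scalar_prod_right_unit)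
  ultimately show ?thesis by simp
qed

text \<open>The net bound for the standard basis, so with \<open>n\<close> indices; homogeneity
  reduces arbitrary vectors to normalised ones.\<close>

lemma bernoulli_matrix_operator_norm_tail:
  assumes "T \<ge> 0"
  shows "measure_pmf.prob (bernoulli_matrix n)
           {E. \<exists>x\<in>carrier_vec n. \<exists>y\<in>carrier_vec n. x \<bullet> (E *\<^sub>v y) > T * sqrt (x \<bullet> x) * sqrt (y \<bullet> y)}
         \<le> 2304 ^ n * exp (- T\<^sup>2 / 32)"
    (is "measure_pmf.prob _ ?bad \<le> _")
proof -
  let ?prob = "measure_pmf.prob (bernoulli_matrix n)"
  let ?bad' = "{E. \<exists>a b. (\<Sum>i\<in>{..<n}. (a i)\<^sup>2) \<le> 1 \<and> (\<Sum>i\<in>{..<n}. (b i)\<^sup>2) \<le> 1 \<and>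
      (\<Sum>i\<in>{..<n}. \<Sum>j\<in>{..<n}. a i * b j * (unit_vec n i \<bullet> (E *\<^sub>v unit_vec n j))) > T}"
  have "?bad \<inter> set_pmf (bernoulli_matrix n) \<subseteq> ?bad'"
  proof
    fix E assume "E \<in> ?bad \<inter> set_pmf (bernoulli_matrix n)"
    then obtain x y where E: "E \<in> carrier_mat n n" and x: "x \<in> carrier_vec n" and y: "y \<in> carrier_vec n"
      and gt: "x \<bullet> (E *\<^sub>v y) > T * sqrt (x \<bullet> x) * sqrt (y \<bullet> y)"
      using set_pmf_bernoulli_matrix by auto
    let ?nx = "sqrt (x \<bullet> x)" and ?ny = "sqrt (y \<bullet> y)"
    \<comment> \<open>An inequality, since for the zero vector the quotients are 0 by the convention
      for division by zero.\<close>
    have sq: "(\<Sum>i<n. (z $ i / sqrt (z \<bullet> z))\<^sup>2) \<le> 1" if "z \<in> carrier_vec n" for z :: "real Matrix.vec"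
    proof -
      have "(\<Sum>i<n. (z $ i / sqrt (z \<bullet> z))\<^sup>2) = (\<Sum>i<n. (z $ i)\<^sup>2) / (z \<bullet> z)"
        by (simp add: power_divide scalar_prod_self_nonneg sum_divide_distrib)
      also have "(\<Sum>i<n. (z $ i)\<^sup>2) = z \<bullet> z"
        using that by (simp add: scalar_prod_def power2_eq_square atLeast0LessThan)
      finally show ?thesis by simp
    qed
    \<comment> \<open>Were \<open>x\<close> or \<open>y\<close> of norm 0, Cauchy-Schwarz would make
      the form 0, against the strict inequality \<open>gt\<close>; so both norms may be divided
      out.\<close>
    have "\<bar>x \<bullet> (E *\<^sub>v y)\<bar> \<le> ?nx * sqrt ((E *\<^sub>v y) \<bullet> (E *\<^sub>v y))"
      using E x y by (intro scalar_prod_Cauchy_Schwarz) auto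
    then have nx: "?nx > 0"
      using gt scalar_prod_self_nonneg[of x] by (cases "?nx = 0") (auto simp: less_le)
    have tE: "transpose_mat E *\<^sub>v x \<in> carrier_vec n" using E x by auto
    have "x \<bullet> (E *\<^sub>v y) = (transpose_mat E *\<^sub>v x) \<bullet> y"
      by (rule transpose_vec_mult_scalar[OF E y x, symmetric])
    then have "\<bar>x \<bullet> (E *\<^sub>v y)\<bar> \<le> sqrt ((transpose_mat E *\<^sub>v x) \<bullet> (transpose_mat E *\<^sub>v x)) * ?ny"
      using scalar_prod_Cauchy_Schwarz[OF tE y] by simp
    then have ny: "?ny > 0"
      using gt scalar_prod_self_nonneg[of y] by (cases "?ny = 0") (auto simp: less_le)
    have "T < x \<bullet> (E *\<^sub>v y) / (?nx * ?ny)"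
      using gt nx ny by (simp add: pos_less_divide_eq mult.assoc)
    also have "\<dots> = (\<Sum>i<n. \<Sum>j<n. (x $ i / ?nx) * (y $ j / ?ny) * (unit_vec n i \<bullet> (E *\<^sub>v unit_vec n j)))"
      by (simp add: scalar_prod_mult_mat_eq_sum[OF E x y] sum_divide_distrib)
    finally show "E \<in> ?bad'"
      using sq[OF x] sq[OF y]
      by (intro CollectI exI[of _ "\<lambda>i. x $ i / ?nx"] exI[of _ "\<lambda>j. y $ j / ?ny"] conjI)
  qed
  then have "?prob (?bad \<inter> set_pmf (bernoulli_matrix n)) \<le> ?prob ?bad'"
    by (intro measure_pmf.finite_measure_mono) auto
  then have "?prob ?bad \<le> ?prob ?bad'"
    by (simp only: measure_Int_set_pmf)
  also have "\<dots> \<le> 2304 ^ n * exp (- T\<^sup>2 / 32)"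
    using bernoulli_matrix_orthonormal_tail[OF _ orthonormal_family_unit_vec orthonormal_family_unit_vec assms, of n]
    by simp
  finally show ?thesis .
qed

section \<open>Singular values and singular bases\<close>

lemma right_singular_basisD:
  assumes M: "M \<in> carrier_mat n n" and v: "right_singular_basis M v"
  shows "orthonormal_family n {1..n} v"
    and "i \<in> {1..n} \<Longrightarrow> (transpose_mat M * M) *\<^sub>v v i = (singular_value M i)\<^sup>2 \<cdot>\<^sub>v v i"
proof -
  show "orthonormal_family n {1..n} v"
    using assms by (auto simp: right_singular_basis_def orthonormal_family_def eigenvector_def)
  show "(transpose_mat M * M) *\<^sub>v v i = (singular_value M i)\<^sup>2 \<cdot>\<^sub>v v i" if "i \<in> {1..n}"
    using v that M unfolding right_singular_basis_def eigenvector_def by (metis carrier_matD(2))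
qed

lemma proots_prod_linear_factors: "proots (\<Prod>a\<leftarrow>xs. [:- a, 1:]) = mset (xs :: 'a :: idom list)"
proof (induction xs)
  case (Cons a xs)
  have "(\<Prod>a\<leftarrow>xs. [:- a, 1:]) \<noteq> 0"
    by (auto simp: prod_list_zero_iff)
  then show ?case using Cons by (simp add: proots_mult del: mult_pCons_left)
qed simp

text \<open>The basis vectors form an orthogonal matrix \<open>V\<close> that conjugates
  \<open>M\<^sup>T M\<close> to the diagonal matrix \<open>D\<close>, so the characteristic
  polynomial splits with exactly these roots. Although singular values occur on both sides, the
  equation shows that the list has length \<open>n\<close> and consists of square roots of sorted
  nonnegative numbers; nonnegativity and monotonicity are read off from it.\<close>

lemma singular_values_right_singular_basis:
  assumes M: "M \<in> carrier_mat n n" and v: "right_singular_basis M v"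
  shows "singular_values M = map sqrt (rev (sort (map (\<lambda>i. (singular_value M (Suc i))\<^sup>2) [0..<n])))"
proof -
  note on = right_singular_basisD(1)[OF M v]
  let ?S = "transpose_mat M * M"
  let ?s = "\<lambda>i. (singular_value M (Suc i))\<^sup>2"
  define V where "V = Matrix.mat n n (\<lambda>(k, i). v (Suc i) $ k)"
  define D where "D = Matrix.mat n n (\<lambda>(i, j). if i = j then ?s i else 0)"
  have S: "?S \<in> carrier_mat n n" and V: "V \<in> carrier_mat n n" and D: "D \<in> carrier_mat n n"
    using M by (auto simp: V_def D_def)
  have colV: "col V i = v (Suc i)" if "i < n" for i
    using that orthonormal_familyD(1)[OF on, of "Suc i"] by (auto simp: V_def)
  have VV: "transpose_mat V * V = 1\<^sub>m n"
  proof (rule eq_matI)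
    fix i j assume ij: "i < dim_row (1\<^sub>m n)" "j < dim_col (1\<^sub>m n)"
    then have "(transpose_mat V * V) $$ (i, j) = v (Suc i) \<bullet> v (Suc j)"
      using V by (simp add: colV)
    then show "(transpose_mat V * V) $$ (i, j) = 1\<^sub>m n $$ (i, j)"
      using ij orthonormal_familyD(2)[OF on, of "Suc i" "Suc j"] by simp
  qed (use V in auto)
  then have VV': "V * transpose_mat V = 1\<^sub>m n"
    using V by (intro mat_mult_left_right_inverse[of "transpose_mat V" n V]) auto
  have SV: "?S * V = V * D"
  proof (rule eq_matI)
    fix k i assume "k < dim_row (V * D)" "i < dim_col (V * D)"
    then have ki: "k < n" "i < n" using V D by auto
    have "(?S * V) $$ (k, i) = (?S *\<^sub>v v (Suc i)) $ k"
      using ki S V carrier_matD[OF S] unfolding mult_mat_vec_def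
      by (simp only: index_mult_mat(1) carrier_matD index_vec colV)
    also have "\<dots> = ?s i * V $$ (k, i)"
      using ki right_singular_basisD(2)[OF M v, of "Suc i"] orthonormal_familyD(1)[OF on, of "Suc i"]
      by (simp add: V_def)
    also have "\<dots> = (\<Sum>l\<in>{0..<n}. V $$ (k, l) * D $$ (l, i))"
      using ki by (simp add: D_def if_distrib cong: if_cong)
    also have "\<dots> = (V * D) $$ (k, i)"
      using ki V D by (simp add: scalar_prod_def)
    finally show "(?S * V) $$ (k, i) = (V * D) $$ (k, i)" .
  qed (use V D S M in auto)
  have "?S = ?S * (V * transpose_mat V)"
    using right_mult_one_mat[OF S] by (simp only: VV')
  also have "\<dots> = V * D * transpose_mat V"
    using S V by (subst assoc_mult_mat[symmetric, OF S V, of _ n]) (auto simp: SV)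
  finally have "similar_mat ?S D"
    using S V D VV VV'
    by (intro similar_matI[of _ _ V "transpose_mat V" n]) auto
  then have "char_poly ?S = char_poly D"
    by (rule char_poly_similar)
  also have "\<dots> = (\<Prod>a\<leftarrow>diag_mat D. [:- a, 1:])"
    by (rule char_poly_upper_triangular[OF D]) (auto simp: D_def upper_triangular_def)
  also have "diag_mat D = map ?s [0..<n]"
    by (simp add: diag_mat_def D_def)
  finally have char_poly: "char_poly ?S = (\<Prod>a\<leftarrow>map ?s [0..<n]. [:- a, 1:])" .
  have "proots (char_poly ?S) = mset (map ?s [0..<n])"
    unfolding char_poly by (rule proots_prod_linear_factors)
  then show ?thesis
    unfolding singular_values_def by (simp only: sorted_list_of_multiset_mset)
qed

lemma singular_value_nonneg:
  assumes "M \<in> carrier_mat n n" "right_singular_basis M v" "i \<in> {1..n}"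
  shows "singular_value M i \<ge> 0"
proof -
  let ?xs = "map (\<lambda>i. (singular_value M (Suc i))\<^sup>2) [0..<n]"
  have "i - 1 < length (rev (sort ?xs))"
    using assms(3) by auto
  then have "rev (sort ?xs) ! (i - 1) \<in> set ?xs"
    by (metis nth_mem set_rev set_sort)
  then have "rev (sort ?xs) ! (i - 1) \<ge> 0" by auto
  moreover have "singular_value M i = sqrt (rev (sort ?xs) ! (i - 1))"
    unfolding singular_value_def[of M i] singular_values_right_singular_basis[OF assms(1,2)]
    using assms(3) by (subst nth_map) auto
  ultimately show ?thesis by simp
qed

lemma singular_value_antimono:
  assumes "M \<in> carrier_mat n n" "right_singular_basis M v" "1 \<le> i" "i \<le> j" "j \<le> n"
  shows "singular_value M j \<le> singular_value M i"
proof -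
  let ?xs = "map (\<lambda>i. (singular_value M (Suc i))\<^sup>2) [0..<n]"
  have "rev (sort ?xs) ! (j - 1) \<le> rev (sort ?xs) ! (i - 1)"
    using assms(3-5) by (intro sorted_rev_nth_mono) auto
  moreover have "singular_value M k = sqrt (rev (sort ?xs) ! (k - 1))" if "k \<in> {1..n}" for k
    unfolding singular_value_def[of M k] singular_values_right_singular_basis[OF assms(1,2)]
    using that by (subst nth_map) auto
  ultimately show ?thesis using assms(3-5) by simp
qed

lemma right_singular_basis_images_orthogonal:
  assumes M: "M \<in> carrier_mat n n" and v: "right_singular_basis M v"
    and i: "i \<in> {1..n}" and j: "j \<in> {1..n}"
  shows "(M *\<^sub>v v i) \<bullet> (M *\<^sub>v v j) = (if i = j then (singular_value M i)\<^sup>2 else 0)"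
proof -
  note on = right_singular_basisD(1)[OF M v]
  have vi: "v i \<in> carrier_vec n" and vj: "v j \<in> carrier_vec n"
    using orthonormal_familyD(1)[OF on] i j by auto
  have "(M *\<^sub>v v i) \<bullet> (M *\<^sub>v v j) = (transpose_mat M *\<^sub>v (M *\<^sub>v v i)) \<bullet> v j"
    using M vi vj by (intro transpose_vec_mult_scalar[symmetric]) auto
  also have "transpose_mat M *\<^sub>v (M *\<^sub>v v i) = (transpose_mat M * M) *\<^sub>v v i"
    using M vi by (intro assoc_mult_mat_vec[symmetric]) auto
  also have "\<dots> = (singular_value M i)\<^sup>2 \<cdot>\<^sub>v v i"
    by (rule right_singular_basisD(2)[OF M v i])
  also have "\<dots> \<bullet> v j = (singular_value M i)\<^sup>2 * (v i \<bullet> v j)"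
    using vi vj by simp
  finally show ?thesis using orthonormal_familyD(2)[OF on i j] by simp
qed

text \<open>In the basis \<open>v\<close> the images are orthogonal, so the left side is the sum of
  the \<open>(singular_value M i)\<^sup>2 * (v i \<bullet> x)\<^sup>2\<close>; the first singular
  value is the largest, and Parseval finishes.\<close>

lemma singular_value_1_bounds_image:
  assumes M: "M \<in> carrier_mat n n" and v: "right_singular_basis M v" and x: "x \<in> carrier_vec n"
  shows "(M *\<^sub>v x) \<bullet> (M *\<^sub>v x) \<le> (singular_value M 1)\<^sup>2 * (x \<bullet> x)"
proof -
  note on = right_singular_basisD(1)[OF M v]
  have vC: "v i \<in> carrier_vec n" if "i \<in> {1..n}" for i
    using orthonormal_familyD(1)[OF on that] .
  have Mx: "M *\<^sub>v x \<in> carrier_vec n" using M x by auto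
  have expand: "combo n {1..n} (\<lambda>i. v i \<bullet> x) v = x"
    by (rule orthonormal_basis_expansion[OF _ _ on x]) auto
  have y: "y \<bullet> (M *\<^sub>v x) = (\<Sum>i\<in>{1..n}. (v i \<bullet> x) * (y \<bullet> (M *\<^sub>v v i)))" if "y \<in> carrier_vec n" for y
    using scalar_prod_mult_mat_combo[OF M that, where I = "{1..n}" and u = v and a = "\<lambda>i. v i \<bullet> x"]
    unfolding expand using vC by blast
  have Mv: "(M *\<^sub>v x) \<bullet> (M *\<^sub>v v i) = (v i \<bullet> x) * (singular_value M i)\<^sup>2" if i: "i \<in> {1..n}" for i
  proof -
    have Mvi: "M *\<^sub>v v i \<in> carrier_vec n" using M vC[OF i] by auto
    have "(M *\<^sub>v x) \<bullet> (M *\<^sub>v v i) = (M *\<^sub>v v i) \<bullet> (M *\<^sub>v x)"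
      by (rule comm_scalar_prod[OF Mx Mvi])
    also have "\<dots> = (\<Sum>j\<in>{1..n}. (v j \<bullet> x) * (if i = j then (singular_value M i)\<^sup>2 else 0))"
      unfolding y[OF Mvi] by (intro sum.cong refl) (simp only: right_singular_basis_images_orthogonal[OF M v i])
    also have "\<dots> = (v i \<bullet> x) * (singular_value M i)\<^sup>2"
      using i by (simp add: if_distrib cong: if_cong)
    finally show ?thesis .
  qed
  have "(M *\<^sub>v x) \<bullet> (M *\<^sub>v x) = (\<Sum>i\<in>{1..n}. (singular_value M i)\<^sup>2 * (v i \<bullet> x)\<^sup>2)"
    unfolding y[OF Mx] by (intro sum.cong refl) (simp add: Mv power2_eq_square)
  also have "\<dots> \<le> (\<Sum>i\<in>{1..n}. (singular_value M 1)\<^sup>2 * (v i \<bullet> x)\<^sup>2)"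
    using singular_value_nonneg[OF M v] singular_value_antimono[OF M v, of 1]
    by (intro sum_mono mult_right_mono power_mono) auto
  also have "\<dots> = (singular_value M 1)\<^sup>2 * (x \<bullet> x)"
    using orthonormal_basis_parseval[OF _ _ on x] by (simp add: sum_distrib_left)
  finally show ?thesis .
qed

text \<open>The images of these basis vectors are orthogonal and nonzero. This is how the rank
  enters: it limits the dimension of the net for the compressed matrix.\<close>

lemma right_singular_basis_rank_bound:
  fixes A :: "real mat"
  assumes A: "A \<in> carrier_mat n n" and v: "right_singular_basis A v"
  shows "card {i \<in> {1..n}. singular_value A i > 0} \<le> vec_space.rank n A"
  using right_singular_basis_images_orthogonal[OF A v] orthonormal_familyD(1)[OF right_singular_basisD(1)[OF A v]]
  by (intro orthogonal_mult_vectors_le_rank[OF A, where w = v]) auto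

text \<open>These are the left singular vectors of \<open>A\<close>, available where the singular
  value is positive.\<close>

lemma orthonormal_left_singular_family:
  assumes A: "A \<in> carrier_mat n n" and v: "right_singular_basis A v"
  shows "orthonormal_family n {i \<in> {1..n}. singular_value A i > 0}
           (\<lambda>i. (1 / singular_value A i) \<cdot>\<^sub>v (A *\<^sub>v v i))"
  unfolding orthonormal_family_def
proof (intro conjI ballI)
  have C: "A *\<^sub>v v i \<in> carrier_vec n" if "i \<in> {1..n}" for i
    using A orthonormal_familyD(1)[OF right_singular_basisD(1)[OF A v] that] by auto
  fix i assume i: "i \<in> {i \<in> {1..n}. singular_value A i > 0}"
  then show "(1 / singular_value A i) \<cdot>\<^sub>v (A *\<^sub>v v i) \<in> carrier_vec n"
    using C by simp
  fix j assume j: "j \<in> {i \<in> {1..n}. singular_value A i > 0}"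
  show "((1 / singular_value A i) \<cdot>\<^sub>v (A *\<^sub>v v i)) \<bullet> ((1 / singular_value A j) \<cdot>\<^sub>v (A *\<^sub>v v j))
          = (if i = j then 1 else 0)"
    using i j C[of i] C[of j] right_singular_basis_images_orthogonal[OF A v, of i j]
    by (cases "i = j") (simp_all add: power2_eq_square)
qed

section \<open>Perturbation of the first singular vector\<close>

text \<open>The deterministic half of the argument: \<open>E\<close> enters only through
  \<open>T\<close>, which bounds its compression to the spans of the \<open>u i\<close> and
  \<open>v j\<close>, and through its operator norm bound \<open>N\<close>. The assumption
  \<open>2 * T \<le> s 1\<close> keeps the top singular value of \<open>A + E\<close> above
  \<open>s 1 / 2\<close>, which accounts for the 4 in the conclusion.\<close>

lemma first_singular_vector_perturbation:
  fixes A E :: "real mat" and v v' :: "nat \<Rightarrow> real Matrix.vec" and T N :: real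
  assumes A: "A \<in> carrier_mat n n" and E: "E \<in> carrier_mat n n" and n: "n \<ge> 2"
    and v: "right_singular_basis A v" and v': "right_singular_basis (A + E) v'"
    and s_def: "s = singular_value A"
    and I_def: "I = {i \<in> {1..n}. s i > 0}"
    and u_def: "u = (\<lambda>i. (1 / s i) \<cdot>\<^sub>v (A *\<^sub>v v i))"
    and T: "\<And>a b. (\<Sum>i\<in>I. (a i)\<^sup>2) \<le> 1 \<Longrightarrow> (\<Sum>i\<in>I. (b i)\<^sup>2) \<le> 1 \<Longrightarrow>
                (\<Sum>i\<in>I. \<Sum>j\<in>I. a i * b j * (u i \<bullet> (E *\<^sub>v v j))) \<le> T"
    and N: "\<And>x y. x \<in> carrier_vec n \<Longrightarrow> y \<in> carrier_vec n \<Longrightarrow>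
              x \<bullet> (E *\<^sub>v y) \<le> N * sqrt (x \<bullet> x) * sqrt (y \<bullet> y)"
    and N0: "N \<ge> 0" and s1: "s 1 > 0" and T_s1: "2 * T \<le> s 1"
  shows "(s 1 - s 2) * (1 - \<bar>v 1 \<bullet> v' 1\<bar>) \<le> 2 * T + 4 * N\<^sup>2 / s 1"
proof -
  let ?M = "A + E"
  have M: "?M \<in> carrier_mat n n" using A E by simp
  note onv = right_singular_basisD(1)[OF A v]
  note onv' = right_singular_basisD(1)[OF M v']
  have fin: "finite I" and one: "1 \<in> I" using n s1 by (auto simp: I_def)
  have IN: "i \<in> {1..n}" "s i > 0" if "i \<in> I" for i using that by (auto simp: I_def)
  have vC: "v i \<in> carrier_vec n" if "i \<in> {1..n}" for i using orthonormal_familyD(1)[OF onv that] .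
  have vCI: "v i \<in> carrier_vec n" if "i \<in> I" for i using vC IN(1)[OF that] .
  have AvC: "A *\<^sub>v v i \<in> carrier_vec n" if "i \<in> {1..n}" for i using A vC[OF that] by auto
  have uC: "u i \<in> carrier_vec n" if "i \<in> I" for i
    using AvC[OF IN(1)[OF that]] by (simp add: u_def)
  have onvI: "orthonormal_family n I v"
    using onv by (auto simp: orthonormal_family_def I_def)
  have onu: "orthonormal_family n I u"
    using orthonormal_left_singular_family[OF A v] by (simp add: I_def u_def s_def)
  have yAv: "y \<bullet> (A *\<^sub>v v i) = (if i \<in> I then s i * (y \<bullet> u i) else 0)"
    if y: "y \<in> carrier_vec n" and i: "i \<in> {1..n}" for y i
  proof (cases "i \<in> I")
    case True
    then show ?thesis
      using y AvC[OF i] IN(2)[OF True] by (simp add: u_def)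
  next
    case False
    then have "s i = 0"
      using i singular_value_nonneg[OF A v i] by (simp add: I_def s_def)
    then have "(A *\<^sub>v v i) \<bullet> (A *\<^sub>v v i) = 0"
      using right_singular_basis_images_orthogonal[OF A v i i] by (simp add: s_def)
    then show ?thesis
      using scalar_prod_Cauchy_Schwarz[OF y AvC[OF i]] False by simp
  qed
  \<comment> \<open>The singular value decomposition of \<open>A\<close> in weak form: basis vectors
    outside \<open>I\<close> are annihilated by \<open>A\<close>.\<close>
  have yAx: "y \<bullet> (A *\<^sub>v x) = (\<Sum>i\<in>I. (v i \<bullet> x) * (s i * (y \<bullet> u i)))"
    if y: "y \<in> carrier_vec n" and x: "x \<in> carrier_vec n" for x y
  proof -
    have "y \<bullet> (A *\<^sub>v x) = y \<bullet> (A *\<^sub>v combo n {1..n} (\<lambda>i. v i \<bullet> x) v)"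
      using orthonormal_basis_expansion[OF _ _ onv x] by simp
    also have "\<dots> = (\<Sum>i\<in>{1..n}. (v i \<bullet> x) * (y \<bullet> (A *\<^sub>v v i)))"
      by (rule scalar_prod_mult_mat_combo[OF A y vC])
    also have "\<dots> = (\<Sum>i\<in>{1..n}. if i \<in> I then (v i \<bullet> x) * (s i * (y \<bullet> u i)) else 0)"
      by (intro sum.cong refl) (simp add: yAv[OF y])
    also have "\<dots> = (\<Sum>i\<in>I. (v i \<bullet> x) * (s i * (y \<bullet> u i)))"
      by (simp add: I_def flip: sum.inter_filter)
    finally show ?thesis .
  qed
  have Mx: "?M *\<^sub>v x \<in> carrier_vec n" if "x \<in> carrier_vec n" for x using M that by auto
  have yMx: "y \<bullet> (?M *\<^sub>v x) = y \<bullet> (A *\<^sub>v x) + y \<bullet> (E *\<^sub>v x)"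
    if "x \<in> carrier_vec n" "y \<in> carrier_vec n" for x y
    using that A E by (subst add_mult_distrib_mat_vec[OF A E]) (auto intro: scalar_prod_add_distrib)

  define \<sigma> where "\<sigma> = singular_value ?M 1"
  have \<sigma>0: "\<sigma> \<ge> 0"
    using n singular_value_nonneg[OF M v', of 1] by (simp add: \<sigma>_def)
  have v1C: "v 1 \<in> carrier_vec n" and v11: "v 1 \<bullet> v 1 = 1"
    using vC n orthonormal_familyD(2)[OF onv, of 1 1] by auto
  have u1C: "u 1 \<in> carrier_vec n" and u11: "u 1 \<bullet> u 1 = 1"
    using uC one orthonormal_familyD(2)[OF onu, of 1 1] by auto
  \<comment> \<open>\<open>A + E\<close> is tested on the pair \<open>u 1\<close>,
    \<open>v 1\<close>. As \<open>T\<close> bounds the form only from above, \<open>a\<close>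
    carries a minus sign, which turns it into a lower bound for
    \<open>u 1 \<bullet> (E *\<^sub>v v 1)\<close>.\<close>
  have "s 1 - T \<le> \<sigma>"
  proof -
    define a b :: "nat \<Rightarrow> real" where "a = (\<lambda>i. if i = 1 then -1 else 0)" and "b = (\<lambda>i. if i = 1 then 1 else 0)"
    have "(\<Sum>i\<in>I. \<Sum>j\<in>I. a i * b j * (u i \<bullet> (E *\<^sub>v v j)))
        = (\<Sum>i\<in>I. \<Sum>j\<in>I. if j = 1 then a i * (u i \<bullet> (E *\<^sub>v v 1)) else 0)"
      by (intro sum.cong refl) (simp add: b_def)
    also have "\<dots> = (\<Sum>i\<in>I. a i * (u i \<bullet> (E *\<^sub>v v 1)))"
      by (simp only: sum.delta[OF fin] one if_True)
    also have "\<dots> = (\<Sum>i\<in>I. if i = 1 then - (u 1 \<bullet> (E *\<^sub>v v 1)) else 0)"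
      by (intro sum.cong refl) (simp add: a_def)
    also have "\<dots> = - (u 1 \<bullet> (E *\<^sub>v v 1))"
      by (simp only: sum.delta[OF fin] one if_True)
    finally have "- (u 1 \<bullet> (E *\<^sub>v v 1)) = (\<Sum>i\<in>I. \<Sum>j\<in>I. a i * b j * (u i \<bullet> (E *\<^sub>v v j)))" by simp
    moreover have "(\<Sum>i\<in>I. (a i)\<^sup>2) = (\<Sum>i\<in>I. if i = 1 then 1 else 0)"
      by (intro sum.cong refl) (simp add: a_def)
    moreover have "(\<Sum>i\<in>I. (b i)\<^sup>2) = (\<Sum>i\<in>I. if i = 1 then 1 else 0)"
      by (intro sum.cong refl) (simp add: b_def)
    moreover have "(\<Sum>i\<in>I. if i = 1 then 1 else 0 :: real) = 1"
      by (simp only: sum.delta[OF fin] one if_True)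
    ultimately have "- (u 1 \<bullet> (E *\<^sub>v v 1)) \<le> T"
      using T[of a b] by simp
    moreover have "u 1 \<bullet> (A *\<^sub>v v 1) = s 1"
      using yAv[OF u1C, of 1] one n u11 by simp
    ultimately have "s 1 - T \<le> u 1 \<bullet> (?M *\<^sub>v v 1)"
      using yMx[OF v1C u1C] by simp
    also have "\<dots> \<le> sqrt ((?M *\<^sub>v v 1) \<bullet> (?M *\<^sub>v v 1))"
      using scalar_prod_Cauchy_Schwarz[OF u1C Mx[OF v1C]] by (simp add: u11 del: One_nat_def)
    also have "\<dots> \<le> \<sigma>"
      using singular_value_1_bounds_image[OF M v' v1C] \<sigma>0
      by (simp add: v11 \<sigma>_def real_le_lsqrt del: One_nat_def)
    finally show ?thesis .
  qed
  with T_s1 s1 have \<sigma>_half: "\<sigma> \<ge> s 1 / 2" and \<sigma>: "\<sigma> > 0" by linarith+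

  \<comment> \<open>The first right and left singular vectors of \<open>?M\<close>;
    \<open>zMx\<close> and \<open>yMz\<close> below express that \<open>?M\<close> maps
    \<open>x\<close> to \<sigma> y and its transpose maps \<open>y\<close> to \<sigma> x.\<close>
  define x where "x = v' 1"
  define y where "y = (1 / \<sigma>) \<cdot>\<^sub>v (?M *\<^sub>v x)"
  have xC: "x \<in> carrier_vec n" and xx: "x \<bullet> x = 1"
    using orthonormal_familyD[OF onv', of 1] n by (auto simp: x_def)
  have yC: "y \<in> carrier_vec n" using Mx[OF xC] by (simp add: y_def)
  have yy: "y \<bullet> y = 1"
    using right_singular_basis_images_orthogonal[OF M v', of 1 1] n Mx[OF xC] \<sigma>
    by (simp add: y_def x_def \<sigma>_def power2_eq_square)
  have zMx: "z \<bullet> (?M *\<^sub>v x) = \<sigma> * (z \<bullet> y)" if "z \<in> carrier_vec n" for z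
    using that Mx[OF xC] \<sigma> by (simp add: y_def)
  have yMz: "y \<bullet> (?M *\<^sub>v z) = \<sigma> * (z \<bullet> x)" if z: "z \<in> carrier_vec n" for z
  proof -
    have "\<sigma> * (y \<bullet> (?M *\<^sub>v z)) = (?M *\<^sub>v x) \<bullet> (?M *\<^sub>v z)"
      using Mx[OF xC] Mx[OF z] \<sigma> by (simp add: y_def)
    also have "\<dots> = (transpose_mat ?M *\<^sub>v (?M *\<^sub>v x)) \<bullet> z"
      using M xC z by (intro transpose_vec_mult_scalar[symmetric]) auto
    also have "transpose_mat ?M *\<^sub>v (?M *\<^sub>v x) = (transpose_mat ?M * ?M) *\<^sub>v x"
      using M xC by (intro assoc_mult_mat_vec[symmetric]) auto
    also have "\<dots> = \<sigma>\<^sup>2 \<cdot>\<^sub>v x"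
      using right_singular_basisD(2)[OF M v', of 1] n by (simp add: x_def \<sigma>_def)
    also have "\<dots> \<bullet> z = \<sigma> * (\<sigma> * (z \<bullet> x))"
      using xC z by (simp add: power2_eq_square comm_scalar_prod[OF xC z])
    finally show ?thesis using \<sigma> by simp
  qed

  define \<alpha> where "\<alpha> = (\<lambda>i. v i \<bullet> x)"
  define \<beta> where "\<beta> = (\<lambda>i. u i \<bullet> y)"
  have \<alpha>_sq: "(\<Sum>i\<in>I. (\<alpha> i)\<^sup>2) \<le> 1"
    using bessel_inequality[OF fin onvI xC] by (simp add: \<alpha>_def xx)
  have \<beta>_sq: "(\<Sum>i\<in>I. (\<beta> i)\<^sup>2) \<le> 1"
    using bessel_inequality[OF fin onu yC] by (simp add: \<beta>_def yy)
  \<comment> \<open>\<open>p\<close> and \<open>f\<close> are the orthogonal projections of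
    \<open>x\<close> and \<open>y\<close> to the row and column space of \<open>A\<close>;
    \<open>q\<close> and \<open>g\<close> are the remainders.\<close>
  define p where "p = combo n I \<alpha> v"
  define f where "f = combo n I \<beta> u"
  define q where "q = x - p"
  define g where "g = y - f"
  have pC: "p \<in> carrier_vec n" and fC: "f \<in> carrier_vec n" by (simp_all add: p_def f_def)
  have qC: "q \<in> carrier_vec n" and gC: "g \<in> carrier_vec n"
    using xC yC pC fC by (simp_all add: q_def g_def)
  have x_pq: "x = p + q" and y_fg: "y = f + g"
    using xC yC pC fC by (auto simp: q_def g_def)
  have vq: "v i \<bullet> q = 0" if i: "i \<in> I" for i
    using scalar_prod_minus_distrib[OF vCI[OF i] xC pC] scalar_prod_orthonormal_combo[OF fin onvI i, of \<alpha>]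
    by (simp add: q_def p_def \<alpha>_def)
  have gu: "g \<bullet> u i = 0" if i: "i \<in> I" for i
    using scalar_prod_minus_distrib[OF uC[OF i] yC fC] scalar_prod_orthonormal_combo[OF fin onu i, of \<beta>]
      comm_scalar_prod[OF gC uC[OF i]]
    by (simp add: g_def f_def \<beta>_def)
  have qp: "q \<bullet> p = 0"
    using vq comm_scalar_prod[OF qC vCI] by (simp add: p_def scalar_prod_combo_right[OF qC vCI])
  have gf: "g \<bullet> f = 0"
    using gu by (simp add: f_def scalar_prod_combo_right[OF gC uC])
  have qq: "q \<bullet> q = q \<bullet> x"
    using scalar_prod_add_distrib[OF qC pC qC] qp by (simp add: x_pq[symmetric])
  have gg: "g \<bullet> g = g \<bullet> y"
    using scalar_prod_add_distrib[OF gC fC gC] gf by (simp add: y_fg[symmetric])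
  txt \<open>The components of the perturbed singular vectors outside the row and column space of \<open>A\<close>
    are produced by \<open>E\<close> alone, hence of size at most \<open>N / \<sigma>\<close>.\<close>
  have small: "sqrt (z \<bullet> z) \<le> N / \<sigma>" if "\<sigma> * (z \<bullet> z) \<le> N * sqrt (z \<bullet> z)" for z
  proof (cases "z \<bullet> z = 0")
    case False
    then have "sqrt (z \<bullet> z) > 0" using scalar_prod_self_nonneg[of z] by simp
    moreover have "\<sigma> * sqrt (z \<bullet> z) * sqrt (z \<bullet> z) \<le> N * sqrt (z \<bullet> z)"
      using that scalar_prod_self_nonneg[of z] by (simp add: mult.assoc)
    ultimately have "\<sigma> * sqrt (z \<bullet> z) \<le> N" by (rule mult_right_le_imp_le[rotated])
    then show ?thesis using \<sigma> by (simp add: pos_le_divide_eq mult.commute)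
  qed (use N0 \<sigma> in simp)
  have q_small: "sqrt (q \<bullet> q) \<le> N / \<sigma>"
  proof (rule small)
    have "\<sigma> * (q \<bullet> q) = y \<bullet> (?M *\<^sub>v q)"
      using yMz[OF qC] qq by simp
    also have "\<dots> = y \<bullet> (E *\<^sub>v q)"
      using yMx[OF qC yC] yAx[OF yC qC] vq by simp
    also have "\<dots> \<le> N * sqrt (q \<bullet> q)"
      using N[OF yC qC] by (simp add: yy)
    finally show "\<sigma> * (q \<bullet> q) \<le> N * sqrt (q \<bullet> q)" .
  qed
  have gEx: "\<sigma> * (g \<bullet> g) = g \<bullet> (E *\<^sub>v x)"
    using zMx[OF gC] gg yMx[OF xC gC] yAx[OF gC xC] gu by simp
  have g_small: "sqrt (g \<bullet> g) \<le> N / \<sigma>"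
    using N[OF gC xC] gEx by (intro small) (simp add: xx)

  have EC: "E *\<^sub>v z \<in> carrier_vec n" if "z \<in> carrier_vec n" for z using E that by auto
  \<comment> \<open>Only \<open>f \<bullet> (E *\<^sub>v p)\<close> sees the compression of
    \<open>E\<close>, bounded by \<open>T\<close>. The other two terms contain a remainder
    \<open>q\<close> or \<open>g\<close>, so each costs at most N * (N / \<sigma>).\<close>
  have "y \<bullet> (E *\<^sub>v x) = f \<bullet> (E *\<^sub>v p) + f \<bullet> (E *\<^sub>v q) + g \<bullet> (E *\<^sub>v x)"
  proof -
    have "y \<bullet> (E *\<^sub>v x) = f \<bullet> (E *\<^sub>v x) + g \<bullet> (E *\<^sub>v x)"
      unfolding y_fg by (rule add_scalar_prod_distrib[OF fC gC EC[OF xC]])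
    also have "f \<bullet> (E *\<^sub>v x) = f \<bullet> (E *\<^sub>v p) + f \<bullet> (E *\<^sub>v q)"
      unfolding x_pq mult_add_distrib_mat_vec[OF E pC qC]
      by (rule scalar_prod_add_distrib[OF fC EC[OF pC] EC[OF qC]])
    finally show ?thesis .
  qed
  also have "f \<bullet> (E *\<^sub>v p) \<le> T"
  proof -
    have "f \<bullet> (E *\<^sub>v p) = (\<Sum>j\<in>I. \<alpha> j * (f \<bullet> (E *\<^sub>v v j)))"
      unfolding p_def by (rule scalar_prod_mult_mat_combo[OF E fC vCI])
    also have "\<dots> = (\<Sum>j\<in>I. \<Sum>i\<in>I. \<beta> i * \<alpha> j * (u i \<bullet> (E *\<^sub>v v j)))"
      by (intro sum.cong refl)
         (simp add: f_def scalar_prod_combo_left[OF EC[OF vCI] uC] sum_distrib_left mult_ac)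
    also have "\<dots> = (\<Sum>i\<in>I. \<Sum>j\<in>I. \<beta> i * \<alpha> j * (u i \<bullet> (E *\<^sub>v v j)))"
      by (rule sum.swap)
    also have "\<dots> \<le> T"
      by (rule T[OF \<beta>_sq \<alpha>_sq])
    finally show ?thesis .
  qed
  also have "f \<bullet> (E *\<^sub>v q) \<le> N * (N / \<sigma>)"
  proof -
    have "sqrt (f \<bullet> f) \<le> 1"
      using \<beta>_sq by (simp add: f_def orthonormal_combo_self[OF fin onu])
    then have "N * sqrt (f \<bullet> f) * sqrt (q \<bullet> q) \<le> N * 1 * (N / \<sigma>)"
      using N0 q_small scalar_prod_self_nonneg by (intro mult_mono) auto
    then show ?thesis using N[OF fC qC] by simp
  qed
  also have "g \<bullet> (E *\<^sub>v x) \<le> N * (N / \<sigma>)"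
    using N[OF gC xC] mult_left_mono[OF g_small N0] by (simp add: xx)
  finally have yEx: "y \<bullet> (E *\<^sub>v x) \<le> T + 2 * (N\<^sup>2 / \<sigma>)"
    by (simp add: power2_eq_square)

  have s2: "s 2 \<ge> 0" "s 2 \<le> s 1"
    using n singular_value_nonneg[OF A v, of 2] singular_value_antimono[OF A v, of 1 2]
    by (auto simp: s_def)
  \<comment> \<open>Every index in \<open>I\<close> is charged \<open>s 2\<close>, and index 1 the
    excess \<open>s 1 - s 2\<close>. The products \<bar>\<alpha> i * \<beta> i\<bar> sum to at most
    1 by the arithmetic-geometric mean inequality and Bessel, and \<bar>\<beta> 1\<bar> \<le>
    1.\<close>
  have yAx_le: "y \<bullet> (A *\<^sub>v x) \<le> s 2 + (s 1 - s 2) * \<bar>\<alpha> 1\<bar>"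
  proof -
    have "(\<beta> 1)\<^sup>2 \<le> (\<Sum>i\<in>I. (\<beta> i)\<^sup>2)"
      by (rule member_le_sum[OF one]) (use fin in auto)
    then have "(\<beta> 1)\<^sup>2 \<le> 1" using \<beta>_sq by linarith
    then have \<beta>1: "\<bar>\<beta> 1\<bar> \<le> 1" by (simp only: abs_square_le_1)
    have "y \<bullet> (A *\<^sub>v x) = (\<Sum>i\<in>I. s i * (\<alpha> i * \<beta> i))"
      unfolding yAx[OF yC xC] using comm_scalar_prod[OF yC uC]
      by (intro sum.cong refl) (simp add: \<alpha>_def \<beta>_def)
    also have "\<dots> \<le> (\<Sum>i\<in>I. (if i = 1 then (s 1 - s 2) * \<bar>\<alpha> 1 * \<beta> 1\<bar> else 0) + s 2 * \<bar>\<alpha> i * \<beta> i\<bar>)"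
    proof (rule sum_mono)
      fix i assume i: "i \<in> I"
      have "s i * (\<alpha> i * \<beta> i) \<le> s i * \<bar>\<alpha> i * \<beta> i\<bar>"
        using IN(2)[OF i] by (intro mult_left_mono) auto
      also have "\<dots> \<le> (if i = 1 then (s 1 - s 2) * \<bar>\<alpha> 1 * \<beta> 1\<bar> else 0) + s 2 * \<bar>\<alpha> i * \<beta> i\<bar>"
      proof (cases "i = 1")
        case False
        then have "s i \<le> s 2"
          using IN(1)[OF i] singular_value_antimono[OF A v, of 2 i] by (auto simp: s_def)
        then show ?thesis using False by (simp add: mult_right_mono)
      qed (simp add: algebra_simps)
      finally show "s i * (\<alpha> i * \<beta> i) \<le> \<dots>" .
    qed
    also have "\<dots> = (s 1 - s 2) * (\<bar>\<alpha> 1\<bar> * \<bar>\<beta> 1\<bar>) + s 2 * (\<Sum>i\<in>I. \<bar>\<alpha> i * \<beta> i\<bar>)"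
      using fin one by (simp add: sum.distrib sum_distrib_left abs_mult)
    also have "\<dots> \<le> (s 1 - s 2) * (\<bar>\<alpha> 1\<bar> * 1) + s 2 * 1"
    proof (intro add_mono mult_left_mono)
      have "(\<Sum>i\<in>I. \<bar>\<alpha> i * \<beta> i\<bar>) \<le> (\<Sum>i\<in>I. ((\<alpha> i)\<^sup>2 + (\<beta> i)\<^sup>2) / 2)"
      proof (rule sum_mono)
        fix i
        have "0 \<le> (\<bar>\<alpha> i\<bar> - \<bar>\<beta> i\<bar>)\<^sup>2" by simp
        then show "\<bar>\<alpha> i * \<beta> i\<bar> \<le> ((\<alpha> i)\<^sup>2 + (\<beta> i)\<^sup>2) / 2"
          by (simp add: power2_diff abs_mult)
      qed
      also have "\<dots> = ((\<Sum>i\<in>I. (\<alpha> i)\<^sup>2) + (\<Sum>i\<in>I. (\<beta> i)\<^sup>2)) / 2"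
        by (simp add: sum.distrib flip: sum_divide_distrib)
      also have "\<dots> \<le> (1 + 1) / 2"
        by (intro divide_right_mono add_mono \<alpha>_sq \<beta>_sq) simp
      finally show "(\<Sum>i\<in>I. \<bar>\<alpha> i * \<beta> i\<bar>) \<le> 1"
        by simp
    qed (use \<beta>1 s2 in auto)
    finally show ?thesis by simp
  qed

  \<comment> \<open>The upper bound for \<sigma> meets the lower bound \<open>s 1 - T\<close>; one
    \<open>T\<close> comes from each side.\<close>
  have "\<sigma> = y \<bullet> (A *\<^sub>v x) + y \<bullet> (E *\<^sub>v x)"
    using zMx[OF yC] yMx[OF xC yC] yy by simp
  with yEx yAx_le \<open>s 1 - T \<le> \<sigma>\<close>
  have "(s 1 - s 2) * (1 - \<bar>\<alpha> 1\<bar>) \<le> 2 * T + 2 * (N\<^sup>2 / \<sigma>)"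
    by (simp add: algebra_simps)
  also have "N\<^sup>2 / \<sigma> \<le> N\<^sup>2 / (s 1 / 2)"
    using \<sigma>_half s1 \<sigma> by (intro divide_left_mono) auto
  finally show ?thesis by (simp add: \<alpha>_def x_def)
qed

section \<open>Choice of constants and the probabilistic conclusion\<close>

lemma sin_unit_angle_le:
  assumes "\<bar>x \<bullet> y\<bar> \<le> 1" "1 - \<bar>x \<bullet> y\<bar> \<le> \<epsilon>\<^sup>2 / 2" "\<epsilon> \<ge> 0"
  shows "sin (unit_angle x y) \<le> \<epsilon>"
proof -
  let ?c = "\<bar>x \<bullet> y\<bar>"
  have "1 - ?c\<^sup>2 = (1 - ?c) * (1 + ?c)"
    by (simp add: power2_eq_square algebra_simps)
  also have "\<dots> \<le> (1 - ?c) * 2"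
    using assms(1) by (intro mult_left_mono) auto
  also have "\<dots> \<le> \<epsilon>\<^sup>2"
    using assms(2) by simp
  finally show ?thesis
    using assms(1,3) unfolding unit_angle_def by (subst sin_arccos) (auto intro: real_le_lsqrt)
qed

text \<open>The factor 32 in both thresholds beats the net size: the tails become e^(-32 n) and
  n^(-32 r), against 2304^n and at most 2304^r. The logarithm makes the second product tend to 0
  even when the rank stays bounded.\<close>

lemma net_size_times_tail_le:
  assumes n: "n \<ge> 2" and r: "1 \<le> r" and k: "k \<le> r"
  shows "2304 ^ n * exp (- (32 * sqrt (real n))\<^sup>2 / 32) \<le> (1/2 :: real) ^ n"
    and "2304 ^ k * exp (- (32 * sqrt (real r * ln (real n)))\<^sup>2 / 32) \<le> 1 / real n"
proof -
  \<comment> \<open>4608 is 2 * 2304; the estimate uses only e \<ge> 2.\<close>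
  have "(4608 :: real) \<le> 2 ^ 32" by simp
  also have "\<dots> \<le> exp 1 ^ 32" by (intro power_mono exp_ge_add_one_self[of 1, simplified]) auto
  also have "\<dots> = exp 32" by (simp flip: exp_of_nat_mult)
  finally have "2304 * exp (- 32) \<le> (1/2 :: real)"
    by (simp add: exp_minus field_simps)
  then have "(2304 * exp (- 32)) ^ n \<le> (1/2 :: real) ^ n"
    by (intro power_mono) auto
  then show "2304 ^ n * exp (- (32 * sqrt (real n))\<^sup>2 / 32) \<le> (1/2 :: real) ^ n"
    by (simp add: power_mult_distrib mult.commute flip: exp_of_nat_mult)
  have pos: "ln (real n) \<ge> 0" using n by simp
  have "(2304 :: real) ^ k \<le> 2304 ^ r"
    using k by (intro power_increasing) auto
  moreover have "exp (- (32 * sqrt (real r * ln (real n)))\<^sup>2 / 32) = (1 / real n ^ 32) ^ r"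
  proof -
    have "exp (- (32 * sqrt (real r * ln (real n)))\<^sup>2 / 32) = exp (real r * (- (32 * ln (real n))))"
      using pos by (simp add: power_mult_distrib)
    also have "\<dots> = exp (- (32 * ln (real n))) ^ r"
      by (rule exp_of_nat_mult)
    also have "exp (- (32 * ln (real n))) = inverse (exp (real 32 * ln (real n)))"
      by (simp add: exp_minus)
    also have "exp (real 32 * ln (real n)) = real n ^ 32"
      using n by (subst exp_of_nat_mult) simp
    finally show ?thesis by (simp add: inverse_eq_divide)
  qed
  ultimately have "2304 ^ k * exp (- (32 * sqrt (real r * ln (real n)))\<^sup>2 / 32)
      \<le> 2304 ^ r * (1 / real n ^ 32) ^ r"
    by (simp add: mult_right_mono)
  also have "\<dots> = (2304 / real n ^ 32) ^ r"
    by (simp add: power_divide)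
  also have "2304 / real n ^ 32 \<le> 1 / real n"
  proof -
    have "(2304 :: real) \<le> 2 ^ 31" by simp
    also have "\<dots> \<le> real n ^ 31" using n by (intro power_mono) auto
    finally have "2304 * real n \<le> real n ^ 31 * real n" by (intro mult_right_mono) auto
    also have "\<dots> = real n ^ 32" by (simp flip: power_Suc2)
    finally show ?thesis using n by (simp add: field_simps)
  qed
  then have "(2304 / real n ^ 32) ^ r \<le> (1 / real n) ^ r"
    by (intro power_mono) auto
  also have "\<dots> \<le> 1 / real n"
    using r n power_decreasing[of 1 r "1 / real n"] by simp
  finally show "2304 ^ k * exp (- (32 * sqrt (real r * ln (real n)))\<^sup>2 / 32) \<le> 1 / real n"
    by simp
qed

theorem corollary7:
  fixes \<epsilon> :: real
  assumes "\<epsilon> > 0"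
  shows "\<exists>C>0. \<exists>p :: nat \<Rightarrow> real. p \<longlonglongrightarrow> 0 \<and>
    (\<forall>n\<ge>2. \<forall>A \<in> carrier_mat n n. \<forall>v\<^sub>1. \<forall>r.
       first_singular_vector A v\<^sub>1 \<longrightarrow>
       r = vec_space.rank n A \<longrightarrow>
       1 \<le> r \<longrightarrow>
       real r \<le> real n powr 0.99 \<longrightarrow>
       real n / sqrt (real r * ln (real n)) \<le> singular_value A 1 \<longrightarrow>
       singular_value A 1 - singular_value A 2 \<ge> C * sqrt (real r * ln (real n)) \<longrightarrow>
       measure_pmf.prob (bernoulli_matrix n)
         {E. \<forall>v\<^sub>1'. first_singular_vector (A + E) v\<^sub>1' \<longrightarrow> sin (unit_angle v\<^sub>1 v\<^sub>1') \<le> \<epsilon>}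
         \<ge> 1 - p n)"
proof -
  txt \<open>With \<open>T = 32 L\<close> and \<open>N = 32 \<surd>n\<close> the perturbation bound is
    \<open>(2 * 32 + 4 * 32\<^sup>2) L = 4160 L\<close>.\<close>
  define C where "C = 64 + 8320 / \<epsilon>\<^sup>2"
  define p :: "nat \<Rightarrow> real" where "p = (\<lambda>n. (1/2) ^ n + 1 / real n)"
  \<comment> \<open>The summand 64 of \<open>C\<close> will give \<open>2 * T \<le> s 1\<close>; the
    other summand makes \<open>4160 / C\<close> small enough for
    \<open>sin_unit_angle_le\<close>.\<close>
  have C64: "C \<ge> 64" and C_pos: "C > 0" and C_eps: "4160 / C \<le> \<epsilon>\<^sup>2 / 2"
  proof -
    have "8320 / \<epsilon>\<^sup>2 > 0" using assms by simp
    then show "C \<ge> 64" "C > 0" by (simp_all add: C_def add_pos_pos)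
    moreover have "8320 \<le> C * \<epsilon>\<^sup>2" using assms by (simp add: C_def field_simps)
    ultimately show "4160 / C \<le> \<epsilon>\<^sup>2 / 2" by (simp add: field_simps)
  qed
  have "p \<longlonglongrightarrow> 0 + 0"
    unfolding p_def by (intro tendsto_add LIMSEQ_power_zero lim_1_over_n) simp
  then have p_lim: "p \<longlonglongrightarrow> 0" by simp
  have "measure_pmf.prob (bernoulli_matrix n)
          {E. \<forall>v\<^sub>1'. first_singular_vector (A + E) v\<^sub>1' \<longrightarrow> sin (unit_angle v\<^sub>1 v\<^sub>1') \<le> \<epsilon>} \<ge> 1 - p n"
    if n: "n \<ge> 2" and A: "A \<in> carrier_mat n n" and v1: "first_singular_vector A v\<^sub>1"
      and r: "r = vec_space.rank n A" and r1: "1 \<le> r"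
      and big: "real n / sqrt (real r * ln (real n)) \<le> singular_value A 1"
      and gap: "singular_value A 1 - singular_value A 2 \<ge> C * sqrt (real r * ln (real n))"
    for n A v\<^sub>1 r
  proof -
    let ?prob = "measure_pmf.prob (bernoulli_matrix n)"
    define L where "L = sqrt (real r * ln (real n))"
    define s where "s = singular_value A"
    obtain v where v: "right_singular_basis A v" and v1_eq: "v\<^sub>1 = v 1"
      using v1 by (auto simp: first_singular_vector_def)
    define I where "I = {i \<in> {1..n}. s i > 0}"
    define u where "u = (\<lambda>i. (1 / s i) \<cdot>\<^sub>v (A *\<^sub>v v i))"
    have L: "L > 0" using n r1 by (simp add: L_def)
    \<comment> \<open>The lower bound on the first singular value reads n / L \<le> s 1; in the form
      n / s 1 \<le> L it makes N^2 / s 1 of order \<open>L\<close>.\<close>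
    have s1: "s 1 > 0" and n_s1: "real n / s 1 \<le> L"
    proof -
      have "0 < real n / L" using n L by simp
      also have "\<dots> \<le> s 1" using big by (simp add: L_def s_def)
      finally show "s 1 > 0" .
      then show "real n / s 1 \<le> L" using \<open>real n / L \<le> s 1\<close> L by (simp add: field_simps)
    qed
    define N where "N = 32 * sqrt (real n)"
    define T where "T = 32 * L"
    have gap': "C * L \<le> s 1 - s 2" using gap by (simp add: L_def s_def)
    \<comment> \<open>As \<open>s 2\<close> is nonnegative, the gap bounds \<open>s 1\<close> itself
      from below: s 1 \<ge> C L \<ge> 64 L = 2 T.\<close>
    have "s 2 \<ge> 0" using singular_value_nonneg[OF A v, of 2] n by (simp add: s_def)
    moreover have "64 * L \<le> C * L" using C64 L by (intro mult_right_mono) auto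
    ultimately have T_s1: "2 * T \<le> s 1" using gap' by (simp add: T_def)
    let ?bad1 = "{E. \<exists>x\<in>carrier_vec n. \<exists>y\<in>carrier_vec n. x \<bullet> (E *\<^sub>v y) > N * sqrt (x \<bullet> x) * sqrt (y \<bullet> y)}"
    let ?bad2 = "{E. \<exists>a b. (\<Sum>i\<in>I. (a i)\<^sup>2) \<le> 1 \<and> (\<Sum>i\<in>I. (b i)\<^sup>2) \<le> 1 \<and>
                     (\<Sum>i\<in>I. \<Sum>j\<in>I. a i * b j * (u i \<bullet> (E *\<^sub>v v j))) > T}"
    let ?good = "{E. \<forall>v\<^sub>1'. first_singular_vector (A + E) v\<^sub>1' \<longrightarrow> sin (unit_angle v\<^sub>1 v\<^sub>1') \<le> \<epsilon>}"
    have finI: "finite I" by (simp add: I_def)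
    have cardI: "card I \<le> r"
      using right_singular_basis_rank_bound[OF A v] by (simp add: I_def s_def r)
    have onv: "orthonormal_family n I v"
      using right_singular_basisD(1)[OF A v] by (auto simp: orthonormal_family_def I_def)
    have onu: "orthonormal_family n I u"
      using orthonormal_left_singular_family[OF A v] by (simp add: I_def u_def s_def)
    have "?prob ?bad1 \<le> 2304 ^ n * exp (- N\<^sup>2 / 32)"
      by (rule bernoulli_matrix_operator_norm_tail) (simp add: N_def)
    then have bad1: "?prob ?bad1 \<le> (1/2) ^ n"
      using net_size_times_tail_le(1)[OF n r1 cardI] by (simp add: N_def)
    have "?prob ?bad2 \<le> 2304 ^ card I * exp (- T\<^sup>2 / 32)"
      by (rule bernoulli_matrix_orthonormal_tail[OF finI onu onv]) (use L in \<open>simp add: T_def\<close>)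
    then have bad2: "?prob ?bad2 \<le> 1 / real n"
      using net_size_times_tail_le(2)[OF n r1 cardI] by (simp only: T_def L_def)
    have "set_pmf (bernoulli_matrix n) - (?bad1 \<union> ?bad2) \<subseteq> ?good"
    proof (intro subsetI CollectI allI impI)
      fix E v\<^sub>1'
      assume E: "E \<in> set_pmf (bernoulli_matrix n) - (?bad1 \<union> ?bad2)"
        and "first_singular_vector (A + E) v\<^sub>1'"
      then obtain v' where v': "right_singular_basis (A + E) v'" and v1': "v\<^sub>1' = v' 1"
        by (auto simp: first_singular_vector_def)
      have EC: "E \<in> carrier_mat n n" using E set_pmf_bernoulli_matrix by blast
      have "(s 1 - s 2) * (1 - \<bar>v 1 \<bullet> v' 1\<bar>) \<le> 2 * T + 4 * N\<^sup>2 / s 1"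
      proof (rule first_singular_vector_perturbation[OF A EC n v v' s_def I_def u_def])
        show "(\<Sum>i\<in>I. \<Sum>j\<in>I. a i * b j * (u i \<bullet> (E *\<^sub>v v j))) \<le> T"
          if "(\<Sum>i\<in>I. (a i)\<^sup>2) \<le> 1" "(\<Sum>i\<in>I. (b i)\<^sup>2) \<le> 1" for a b
          using E that by (auto simp: not_less)
        show "x \<bullet> (E *\<^sub>v y) \<le> N * sqrt (x \<bullet> x) * sqrt (y \<bullet> y)"
          if "x \<in> carrier_vec n" "y \<in> carrier_vec n" for x y
          using E that by (auto simp: not_less)
      qed (use s1 T_s1 in \<open>simp_all add: N_def s_def\<close>)
      also have "4 * N\<^sup>2 / s 1 = 4096 * (real n / s 1)"
        by (simp add: N_def power_mult_distrib)
      also have "2 * T + \<dots> \<le> 4160 * L"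
        using n_s1 by (simp add: T_def)
      finally have le: "(s 1 - s 2) * (1 - \<bar>v 1 \<bullet> v' 1\<bar>) \<le> 4160 * L" .
      have MC: "A + E \<in> carrier_mat n n" using A EC by simp
      have c1: "\<bar>v 1 \<bullet> v' 1\<bar> \<le> 1"
        using scalar_prod_Cauchy_Schwarz[of "v 1" n "v' 1"] n
          orthonormal_familyD[OF right_singular_basisD(1)[OF A v], of 1]
          orthonormal_familyD[OF right_singular_basisD(1)[OF MC v'], of 1] by simp
      \<comment> \<open>By \<open>c1\<close> the factor 1 - \<bar>v 1 \<bullet> v' 1\<bar> is
        nonnegative, so the gap may be replaced by its lower bound, after which \<open>L\<close>
        cancels.\<close>
      have "C * L * (1 - \<bar>v 1 \<bullet> v' 1\<bar>) \<le> (s 1 - s 2) * (1 - \<bar>v 1 \<bullet> v' 1\<bar>)"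
        using gap' c1 by (intro mult_right_mono) auto
      also note le
      finally have "L * (C * (1 - \<bar>v 1 \<bullet> v' 1\<bar>)) \<le> L * 4160"
        by (simp only: mult_ac)
      then have "C * (1 - \<bar>v 1 \<bullet> v' 1\<bar>) \<le> 4160"
        using L by (rule mult_left_le_imp_le)
      then have "1 - \<bar>v 1 \<bullet> v' 1\<bar> \<le> 4160 / C"
        using C_pos by (simp add: pos_le_divide_eq mult.commute)
      then show "sin (unit_angle v\<^sub>1 v\<^sub>1') \<le> \<epsilon>"
        unfolding v1_eq v1' using c1 C_eps assms by (intro sin_unit_angle_le) auto
    qed
    \<comment> \<open>The good event and the two bad events cover the support, so the union bound
      leaves at least \<open>1 - p n\<close> for the good one; the summands of \<open>p n\<close>
      bound the two failures.\<close>
    then have "set_pmf (bernoulli_matrix n) \<subseteq> ?good \<union> (?bad1 \<union> ?bad2)"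
      by blast
    then have "1 = ?prob (?good \<union> (?bad1 \<union> ?bad2))"
      by (intro measure_pmf.prob_eq_1[THEN iffD2, symmetric]) (auto simp: AE_measure_pmf_iff)
    also have "\<dots> \<le> ?prob ?good + (?prob ?bad1 + ?prob ?bad2)"
      by (intro order_trans[OF measure_Un_le] add_left_mono measure_Un_le) auto
    finally show "?prob ?good \<ge> 1 - p n"
      using bad1 bad2 by (simp add: p_def)
  qed
  then show ?thesis
    using C_pos p_lim by blast
qed

end
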